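(* Let $W$ be the group with generators $s_0,s_1,s_2,s_3$ and defining relations $$s_0^2=s_1^2=s_2^2=s_3^2=1,\quad (s_0s_1)^5=(s_1s_2)^3=(s_2s_3)^5=1,\quad s_0s_2=s_2s_0,\; s_1s_3=s_3s_1,\; s_0s_3=s_3s_0,\quad (s_1s_2s_3)^5=1.$$ Then $W$ (with its distinguished generators $s_0,s_1,s_2,s_3$) is a string C-group, and the associated abstract regular polytope $\mathcal{P}$ has dodecahedral facets and hemi-icosahedral vertex figures.
   Context: A group generated by involutions $s_0,\dots,s_{n-1}$ is a string C-group (here also just called a C-group) if $s_is_j=s_js_i$ whenever $j\neq i,i\pm1$, and $\langle s_i:i\in I\rangle\cap\langle s_i:i\in J\rangle=\langle s_i:i\in I\cap J\rangle$ for all $I,J\subseteq\{0,\dots,n-1\}$. The regular polytope associated with a string C-group $W=\langle s_0,\dots,s_{n-1}\rangle$ is the following poset. Put $H_i=\langle s_j: j\ne i\rangle$ for $0\le i\le n-1$. The faces of rank $i$ are the right cosets $H_iw$ ($w\in W$), ordered by $H_iu\le H_jv$ if and only if $i\le j$ and $H_iu\cap H_jv\neq\emptyset$, together with a least face of rank $-1$ and a greatest face of rank $n$. Facets are the faces of rank $n-1$, each identified with the section of all faces below it. A vertex figure is the section of all faces above a vertex (a face of rank $0$). Thus the facets of $\mathcal{P}$ have group $\langle s_0,s_1,s_2\rangle$ and the vertex figures have group $\langle s_1,s_2,s_3\rangle$. The dodecahedron is the regular polytope $\{5,3\}$, whose automorphism group is the Coxeter group $[5,3]$ of order $120$. The hemi-icosahedron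 is the quotient of the icosahedron $\{3,5\}$ by its central (antipodal) symmetry. Its automorphism group, of order $60$, is the Coxeter group $[3,5]=\langle t_0,t_1,t_2\rangle$ with the extra relation $(t_0t_1t_2)^5=1$. *)

theory Defs
  imports "HOL-Algebra.Generated_Groups" "HOL-Algebra.Order"
begin

text \<open>The letter \<open>(x, True)\<close> stands for the generator \<open>x\<close>, and \<open>(x, False)\<close> for its
  formal inverse. A defining relation \<open>l = r\<close> is the pair \<open>(l, r)\<close> of words.\<close>

type_synonym 'a word = "('a \<times> bool) list"

definition words :: "'a set \<Rightarrow> 'a word set" where
  "words S = lists (S \<times> UNIV)"

inductive_set pres_cong :: "'a set \<Rightarrow> ('a word \<times> 'a word) set \<Rightarrow> ('a word \<times> 'a word) set"
  for S :: "'a set" and R :: "('a word \<times> 'a word) set" where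
  refl: "w \<in> words S \<Longrightarrow> (w, w) \<in> pres_cong S R"
| sym: "(v, w) \<in> pres_cong S R \<Longrightarrow> (w, v) \<in> pres_cong S R"
| trans: "(u, v) \<in> pres_cong S R \<Longrightarrow> (v, w) \<in> pres_cong S R \<Longrightarrow> (u, w) \<in> pres_cong S R"
| cancel: "u \<in> words S \<Longrightarrow> v \<in> words S \<Longrightarrow> x \<in> S \<Longrightarrow>
    (u @ [(x, b), (x, \<not> b)] @ v, u @ v) \<in> pres_cong S R"
| relation: "(l, r) \<in> R \<Longrightarrow> u @ l @ v \<in> words S \<Longrightarrow> u @ r @ v \<in> words S \<Longrightarrow>
    (u @ l @ v, u @ r @ v) \<in> pres_cong S R"

definition presented_group :: "'a set \<Rightarrow> ('a word \<times> 'a word) set \<Rightarrow> 'a word set monoid" where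
  "presented_group S R =
    \<lparr>carrier = words S // pres_cong S R,
     mult = (\<lambda>A B. \<Union>u\<in>A. \<Union>v\<in>B. pres_cong S R `` {u @ v}),
     one = pres_cong S R `` {[]}\<rparr>"

definition pres_gen :: "'a set \<Rightarrow> ('a word \<times> 'a word) set \<Rightarrow> 'a \<Rightarrow> 'a word set" where
  "pres_gen S R x = pres_cong S R `` {[(x, True)]}"

definition gens :: "'a list \<Rightarrow> 'a word" where
  "gens xs = map (\<lambda>x. (x, True)) xs"

definition word_pow :: "'a word \<Rightarrow> nat \<Rightarrow> 'a word" where
  "word_pow w k = concat (replicate k w)"

text \<open>The relations of the Coxeter group \<open>[p\<^sub>1, \<dots>, p\<^sub>m]\<close>, on the generators \<open>0, \<dots>, m\<close>.\<close>

definition coxeter_relations :: "nat list \<Rightarrow> (nat word \<times> nat word) set" where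
  "coxeter_relations ps =
    {(gens [i, i], []) | i. i \<le> length ps}
    \<union> {(word_pow (gens [i, Suc i]) (ps ! i), []) | i. i < length ps}
    \<union> {(gens [i, j], gens [j, i]) | i j. Suc i < j \<and> j \<le> length ps}"

abbreviation coxeter_group :: "nat list \<Rightarrow> nat word set monoid" where
  "coxeter_group ps \<equiv> presented_group {..length ps} (coxeter_relations ps)"

abbreviation coxeter_gen :: "nat list \<Rightarrow> nat \<Rightarrow> nat word set" where
  "coxeter_gen ps \<equiv> pres_gen {..length ps} (coxeter_relations ps)"

definition string_C_group :: "('a, 'b) monoid_scheme \<Rightarrow> nat \<Rightarrow> (nat \<Rightarrow> 'a) \<Rightarrow> bool" where
  "string_C_group G n s \<longleftrightarrow>
    group G \<and>
    (\<forall>i<n. s i \<in> carrier G \<and> s i \<noteq> \<one>\<^bsub>G\<^esub> \<and> s i \<otimes>\<^bsub>G\<^esub> s i = \<one>\<^bsub>G\<^esub>) \<and>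
    generate G (s ` {..<n}) = carrier G \<and>
    (\<forall>i<n. \<forall>j<n. j \<noteq> i \<and> j \<noteq> i + 1 \<and> i \<noteq> j + 1 \<longrightarrow> s i \<otimes>\<^bsub>G\<^esub> s j = s j \<otimes>\<^bsub>G\<^esub> s i) \<and>
    (\<forall>I J. I \<subseteq> {..<n} \<and> J \<subseteq> {..<n} \<longrightarrow>
      generate G (s ` I) \<inter> generate G (s ` J) = generate G (s ` (I \<inter> J)))"

datatype 'a face = Least_Face | Coset_Face nat "'a set" | Greatest_Face

definition proper_faces ::
    "('a, 'b) monoid_scheme \<Rightarrow> nat \<Rightarrow> (nat \<Rightarrow> 'a) \<Rightarrow> nat \<Rightarrow> 'a face set" where
  "proper_faces G n s i = Coset_Face i ` (rcosets\<^bsub>G\<^esub> (generate G (s ` ({..<n} - {i}))))"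

fun face_le :: "'a face \<Rightarrow> 'a face \<Rightarrow> bool" where
  "face_le Least_Face Y \<longleftrightarrow> True"
| "face_le (Coset_Face i C) Least_Face \<longleftrightarrow> False"
| "face_le (Coset_Face i C) (Coset_Face j D) \<longleftrightarrow> i \<le> j \<and> C \<inter> D \<noteq> {}"
| "face_le (Coset_Face i C) Greatest_Face \<longleftrightarrow> True"
| "face_le Greatest_Face Y \<longleftrightarrow> Y = Greatest_Face"

definition polytope :: "('a, 'b) monoid_scheme \<Rightarrow> nat \<Rightarrow> (nat \<Rightarrow> 'a) \<Rightarrow> 'a face gorder" where
  "polytope G n s =
    \<lparr>carrier = {Least_Face, Greatest_Face} \<union> (\<Union>i<n. proper_faces G n s i),
     eq = (=),
     le = face_le\<rparr>"

definition section_below :: "'a gorder \<Rightarrow> 'a \<Rightarrow> 'a gorder" where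
  "section_below L F = L\<lparr>carrier := {X \<in> carrier L. X \<sqsubseteq>\<^bsub>L\<^esub> F}\<rparr>"

definition section_above :: "'a gorder \<Rightarrow> 'a \<Rightarrow> 'a gorder" where
  "section_above L F = L\<lparr>carrier := {X \<in> carrier L. F \<sqsubseteq>\<^bsub>L\<^esub> X}\<rparr>"

definition poset_isomorphic :: "'a gorder \<Rightarrow> 'b gorder \<Rightarrow> bool" where
  "poset_isomorphic L M \<longleftrightarrow>
    (\<exists>f. bij_betw f (carrier L) (carrier M) \<and>
      (\<forall>x\<in>carrier L. \<forall>y\<in>carrier L. x \<sqsubseteq>\<^bsub>L\<^esub> y \<longleftrightarrow> f x \<sqsubseteq>\<^bsub>M\<^esub> f y))"

text \<open>The quotient of a poset by the cyclic group generated by an automorphism \<open>\<sigma>\<close> of finite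
  order: its elements are the orbits, and an orbit lies below another one if this holds for some
  representatives.\<close>

definition cyclic_orbit :: "('a \<Rightarrow> 'a) \<Rightarrow> 'a \<Rightarrow> 'a set" where
  "cyclic_orbit \<sigma> x = {(\<sigma> ^^ k) x | k. True}"

definition quotient_poset :: "'a gorder \<Rightarrow> ('a \<Rightarrow> 'a) \<Rightarrow> 'a set gorder" where
  "quotient_poset L \<sigma> =
    \<lparr>carrier = cyclic_orbit \<sigma> ` carrier L,
     eq = (=),
     le = (\<lambda>A B. \<exists>x\<in>A. \<exists>y\<in>B. x \<sqsubseteq>\<^bsub>L\<^esub> y)\<rparr>"

text \<open>The group of a regular polytope acts on the faces by right multiplication.\<close>

fun face_action :: "('a, 'b) monoid_scheme \<Rightarrow> 'a \<Rightarrow> 'a face \<Rightarrow> 'a face" where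
  "face_action G g Least_Face = Least_Face"
| "face_action G g (Coset_Face i C) = Coset_Face i (C #>\<^bsub>G\<^esub> g)"
| "face_action G g Greatest_Face = Greatest_Face"

definition dodecahedron :: "nat word set face gorder" where
  "dodecahedron = polytope (coxeter_group [5, 3]) 3 (coxeter_gen [5, 3])"

definition icosahedron :: "nat word set face gorder" where
  "icosahedron = polytope (coxeter_group [3, 5]) 3 (coxeter_gen [3, 5])"

text \<open>The centre of \<open>[3, 5] \<cong> A\<^sub>5 \<times> C\<^sub>2\<close> has order 2, so it contains exactly one nontrivial
  element, the antipodal symmetry of the icosahedron.\<close>

definition central_element :: "('a, 'b) monoid_scheme \<Rightarrow> 'a" where
  "central_element G = (THE z. z \<in> carrier G \<and> z \<noteq> \<one>\<^bsub>G\<^esub> \<and>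
    (\<forall>g\<in>carrier G. z \<otimes>\<^bsub>G\<^esub> g = g \<otimes>\<^bsub>G\<^esub> z))"

definition hemi_icosahedron :: "nat word set face set gorder" where
  "hemi_icosahedron = quotient_poset icosahedron
    (face_action (coxeter_group [3, 5]) (central_element (coxeter_group [3, 5])))"

definition W_relations :: "(nat word \<times> nat word) set" where
  "W_relations =
    {(gens [0, 0], []), (gens [1, 1], []), (gens [2, 2], []), (gens [3, 3], []),
     (word_pow (gens [0, 1]) 5, []), (word_pow (gens [1, 2]) 3, []), (word_pow (gens [2, 3]) 5, []),
     (gens [0, 2], gens [2, 0]), (gens [1, 3], gens [3, 1]), (gens [0, 3], gens [3, 0]),
     (word_pow (gens [1, 2, 3]) 5, [])}"

definition W_group :: "nat word set monoid" where
  "W_group = presented_group {0, 1, 2, 3} W_relations"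

definition W_gen :: "nat \<Rightarrow> nat word set" where
  "W_gen = pres_gen {0, 1, 2, 3} W_relations"

end

theory Submission
  imports Defs "HOL-Algebra.Sym_Groups"
begin

text \<open>
  Relations bound the parabolic subgroups of \<open>W\<close> from above, and one permutation representation
  bounds them from below. Write \<open>H\<^sub>i\<close> for the subgroup generated by the \<open>s\<^sub>j\<close> with \<open>j \<noteq> i\<close>.

  Upper bounds. The group \<open>[5, 3]\<close> consists of at most 120 elements, given by shortlex normal forms
  (\<open>H3_cover\<close>). Both \<open>s\<^sub>0, s\<^sub>1, s\<^sub>2\<close> and \<open>s\<^sub>3, s\<^sub>2, s\<^sub>1\<close> satisfy its relations, so that these words also
  cover \<open>H\<^sub>3\<close> and \<open>H\<^sub>0\<close>; in \<open>H\<^sub>0\<close> the longest word is trivial because of \<open>(s\<^sub>1 s\<^sub>2 s\<^sub>3)\<^sup>5 = 1\<close>. The groups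
  \<open>H\<^sub>1\<close> and \<open>H\<^sub>2\<close> are products of a dihedral group of order 10 and a group of order 2.

  Lower bounds. There is a homomorphism from \<open>W\<close> into the symmetric group on 266 points, with image
  the Janko group \<open>J\<^sub>1\<close>. It suffices that this is faithful on \<open>H\<^sub>3\<close> and \<open>H\<^sub>0\<close>, which follows from one
  point that has trivial stabilizer in both (\<open>regular_orbit\<close>). So \<open>H\<^sub>3\<close> is isomorphic to \<open>[5, 3]\<close>, and the
  kernel of \<open>[3, 5] \<rightarrow> H\<^sub>0\<close> has order 2; it is the centre of \<open>[3, 5]\<close> because \<open>H\<^sub>0\<close> has trivial centre
  (\<open>icosahedral_kernel\<close>).

  Intersection property. For each \<open>i\<close> the representation has a small orbit of \<open>H\<^sub>i\<close> (\<open>block\<close>) such that a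
  normal form of another \<open>H\<^sub>j\<close> containing the letter \<open>i\<close> moves a point out of the orbit, and therefore is
  not in \<open>H\<^sub>i\<close> (\<open>block_moved\<close>). Hence the letters of the normal form of an element of \<open>H\<^sub>j\<close> occur in every
  parabolic subgroup containing it, which is the intersection property
  (\<open>intersection_property_from_words\<close>).

  Sections. In any string C-group, faces of a facet or of a vertex figure are incident if and only if
  the corresponding cosets in \<open>H\<^sub>n\<^sub>-\<^sub>1\<close> or \<open>H\<^sub>0\<close> meet (\<open>parabolic_product_intersection\<close>). So if a group maps
  onto \<open>H\<^sub>n\<^sub>-\<^sub>1\<close> or \<open>H\<^sub>0\<close>, respecting the generators, then the section is the quotient of its polytope by the
  kernel. For the facets the kernel is trivial and the polytope is the dodecahedron; for the vertex
  figures it is the icosahedron, divided by its antipodal symmetry.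
\<close>

section \<open>Products of words and presented groups\<close>

definition word_prod :: "('a, 'b) monoid_scheme \<Rightarrow> ('i \<Rightarrow> 'a) \<Rightarrow> 'i list \<Rightarrow> 'a" where
  "word_prod G s w = foldr (\<lambda>i x. s i \<otimes>\<^bsub>G\<^esub> x) w \<one>\<^bsub>G\<^esub>"

lemma word_prod_Nil [simp]: "word_prod G s [] = \<one>\<^bsub>G\<^esub>"
  and word_prod_Cons [simp]: "word_prod G s (i # w) = s i \<otimes>\<^bsub>G\<^esub> word_prod G s w"
  by (simp_all add: word_prod_def)

lemma word_prod_map: "word_prod G s (map f w) = word_prod G (\<lambda>i. s (f i)) w"
  by (induction w) auto

lemma (in group) word_prod_closed:
  assumes "s ` set w \<subseteq> carrier G"
  shows "word_prod G s w \<in> carrier G"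
  using assms by (induction w) auto

lemma (in group) word_prod_append:
  assumes "s ` set u \<subseteq> carrier G" "s ` set v \<subseteq> carrier G"
  shows "word_prod G s (u @ v) = word_prod G s u \<otimes> word_prod G s v"
  using assms by (induction u) (auto simp: word_prod_closed m_assoc)

lemma (in group) word_prod_in_generate:
  assumes "set w \<subseteq> I" "s ` I \<subseteq> carrier G"
  shows "word_prod G s w \<in> generate G (s ` I)"
  using assms by (induction w) (auto intro: generate.intros)

lemma (in group_hom) hom_word_prod:
  assumes "s ` set w \<subseteq> carrier G"
  shows "h (word_prod G s w) = word_prod H (\<lambda>i. h (s i)) w"
  using assms by (induction w) (auto simp: G.word_prod_closed)

lemma word_prod_cong: "(\<And>i. i \<in> set w \<Longrightarrow> s i = t i) \<Longrightarrow> word_prod G s w = word_prod G t w"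
  by (induction w) auto

lemma pres_cong_words: "(u, v) \<in> pres_cong S R \<Longrightarrow> u \<in> words S \<and> v \<in> words S"
  by (induction rule: pres_cong.induct) (auto simp: words_def)

lemma equiv_pres_cong: "equiv (words S) (pres_cong S R)"
proof (rule equivI)
  show "pres_cong S R \<subseteq> words S \<times> words S"
    using pres_cong_words by (auto simp del: split_paired_All)
qed (auto simp: refl_on_def sym_def trans_def
    intro: pres_cong.refl pres_cong.sym pres_cong.trans)

lemma words_append: "u @ v \<in> words S \<longleftrightarrow> u \<in> words S \<and> v \<in> words S"
  by (auto simp: words_def)

lemma pres_cong_context:
  assumes "(u, v) \<in> pres_cong S R" "a \<in> words S" "b \<in> words S"
  shows "(a @ u @ b, a @ v @ b) \<in> pres_cong S R"
  using assms
proof (induction rule: pres_cong.induct)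
  case (refl w)
  then show ?case by (intro pres_cong.refl) (simp add: words_append)
next
  case (sym v w)
  then show ?case by (blast intro: pres_cong.sym)
next
  case (trans u v w)
  then show ?case by (blast intro: pres_cong.trans)
next
  case (cancel u v x c)
  then show ?case
    using pres_cong.cancel[of "a @ u" S "v @ b" x c R] by (simp add: words_append)
next
  case (relation l r u v)
  then show ?case
    using pres_cong.relation[of l r R "a @ u" "v @ b" S] by (simp add: words_append)
qed

lemma pres_cong_append:
  assumes "(u, u') \<in> pres_cong S R" "(v, v') \<in> pres_cong S R"
  shows "(u @ v, u' @ v') \<in> pres_cong S R"
  using pres_cong_context[OF assms(1), of "[]" v] pres_cong_context[OF assms(2), of u' "[]"]
    pres_cong_words[OF assms(1)] pres_cong_words[OF assms(2)]
  by (auto simp: words_def intro: pres_cong.trans)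

lemma presented_mult:
  assumes "u \<in> words S" "v \<in> words S"
  shows "pres_cong S R `` {u} \<otimes>\<^bsub>presented_group S R\<^esub> pres_cong S R `` {v} = pres_cong S R `` {u @ v}"
proof -
  have "congruent2 (pres_cong S R) (pres_cong S R) (\<lambda>u v. pres_cong S R `` {u @ v})"
    by (rule congruent2I') (meson equiv_class_eq equiv_pres_cong pres_cong_append)
  from UN_equiv_class2[OF equiv_pres_cong equiv_pres_cong this assms]
  show ?thesis by (simp add: presented_group_def)
qed

definition inv_word :: "'a word \<Rightarrow> 'a word" where
  "inv_word w = rev (map (\<lambda>(x, b). (x, \<not> b)) w)"

lemma inv_word_cancel:
  assumes "w \<in> words S"
  shows "(inv_word w @ w, []) \<in> pres_cong S R"
  using assms
proof (induction w)
  case Nil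
  then show ?case by (auto simp: inv_word_def words_def intro: pres_cong.refl)
next
  case (Cons a w)
  obtain x b where a: "a = (x, b)" by fastforce
  have w: "w \<in> words S" and x: "x \<in> S" using Cons.prems a by (auto simp: words_def)
  then have iw: "inv_word w \<in> words S" by (force simp: words_def inv_word_def)
  have "(inv_word w @ [(x, \<not> b), (x, \<not> \<not> b)] @ w, inv_word w @ w) \<in> pres_cong S R"
    using iw w x by (rule pres_cong.cancel)
  with Cons.IH[OF w] show ?case
    by (auto simp: a inv_word_def intro: pres_cong.trans)
qed

lemma inv_word_words: "w \<in> words S \<Longrightarrow> inv_word w \<in> words S"
  by (force simp: words_def inv_word_def)

lemma carrier_presented: "carrier (presented_group S R) = {pres_cong S R `` {w} | w. w \<in> words S}"
  by (auto simp: presented_group_def quotient_def)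

lemma one_presented: "\<one>\<^bsub>presented_group S R\<^esub> = pres_cong S R `` {[]}"
  by (simp add: presented_group_def)

lemma Nil_words [simp]: "[] \<in> words S" by (simp add: words_def)

lemma presented_group_is_group: "group (presented_group S R)"
proof (rule groupI)
  fix x assume "x \<in> carrier (presented_group S R)"
  then obtain w where w: "w \<in> words S" "x = pres_cong S R `` {w}" by (auto simp: carrier_presented)
  have "pres_cong S R `` {inv_word w} \<otimes>\<^bsub>presented_group S R\<^esub> x = \<one>\<^bsub>presented_group S R\<^esub>"
    using w inv_word_words[OF w(1)] equiv_class_eq[OF equiv_pres_cong inv_word_cancel[OF w(1)]]
    by (simp add: presented_mult one_presented)
  then show "\<exists>y\<in>carrier (presented_group S R). y \<otimes>\<^bsub>presented_group S R\<^esub> x = \<one>\<^bsub>presented_group S R\<^esub>"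
    using inv_word_words[OF w(1)] by (auto simp: carrier_presented)
qed (auto simp: carrier_presented presented_mult one_presented words_append)

lemma pres_gen_closed: "x \<in> S \<Longrightarrow> pres_gen S R x \<in> carrier (presented_group S R)"
  by (auto simp: pres_gen_def carrier_presented words_def)

lemma gens_words: "gens xs \<in> words S \<longleftrightarrow> set xs \<subseteq> S"
  by (auto simp: gens_def words_def)

lemma word_prod_pres_gen:
  assumes "set xs \<subseteq> S"
  shows "word_prod (presented_group S R) (pres_gen S R) xs = pres_cong S R `` {gens xs}"
  using assms
proof (induction xs)
  case (Cons x xs)
  then have "[(x, True)] \<in> words S" "gens xs \<in> words S"
    by (simp_all only: gens_words) (simp_all add: words_def)
  with Cons show ?case
    by (simp add: pres_gen_def presented_mult gens_def)
qed (simp add: one_presented gens_def)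

lemma pres_gen_relation:
  assumes "(gens xs, gens ys) \<in> R" "set xs \<subseteq> S" "set ys \<subseteq> S"
  shows "word_prod (presented_group S R) (pres_gen S R) xs
       = word_prod (presented_group S R) (pres_gen S R) ys"
proof -
  have "(gens xs, gens ys) \<in> pres_cong S R"
    using pres_cong.relation[of "gens xs" "gens ys" R "[]" "[]" S] assms by (simp add: gens_words)
  then show ?thesis
    using assms by (simp add: word_prod_pres_gen equiv_class_eq[OF equiv_pres_cong])
qed

lemma generate_pres_gen:
  "generate (presented_group S R) (pres_gen S R ` S) = carrier (presented_group S R)"
proof
  interpret G: group "presented_group S R" by (rule presented_group_is_group)
  show "generate (presented_group S R) (pres_gen S R ` S) \<subseteq> carrier (presented_group S R)"
    by (rule G.generate_incl) (auto intro: pres_gen_closed)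
  have letter: "pres_cong S R `` {[(x, b)]} \<in> generate (presented_group S R) (pres_gen S R ` S)"
    if x: "x \<in> S" for x b
  proof (cases b)
    case True
    with x show ?thesis by (auto simp: pres_gen_def intro: generate.incl)
  next
    case False
    have w: "[(x, True)] \<in> words S" "[(x, False)] \<in> words S" using x by (auto simp: words_def)
    have "([(x, False), (x, True)], []) \<in> pres_cong S R"
      using pres_cong.cancel[of "[]" S "[]" x False R] x by simp
    then have "pres_cong S R `` {[(x, False)]} \<otimes>\<^bsub>presented_group S R\<^esub> pres_gen S R x
      = \<one>\<^bsub>presented_group S R\<^esub>"
      using w by (simp add: pres_gen_def presented_mult one_presented equiv_class_eq[OF equiv_pres_cong])
    moreover have "pres_cong S R `` {[(x, False)]} \<in> carrier (presented_group S R)"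
      using w by (auto simp: carrier_presented)
    ultimately have "inv\<^bsub>presented_group S R\<^esub> pres_gen S R x = pres_cong S R `` {[(x, False)]}"
      using G.inv_equality pres_gen_closed[OF x] by blast
    then show ?thesis
      using x False generate.inv[of "pres_gen S R x" "pres_gen S R ` S" "presented_group S R"] by simp
  qed
  have "pres_cong S R `` {w} \<in> generate (presented_group S R) (pres_gen S R ` S)" if "w \<in> words S" for w
    using that
  proof (induction w)
    case Nil
    then show ?case
      using generate.one[of "presented_group S R"] by (simp add: one_presented)
  next
    case (Cons a w)
    obtain x b where a: "a = (x, b)" by fastforce
    have w: "w \<in> words S" "x \<in> S" "[(x, b)] \<in> words S" using Cons.prems a by (auto simp: words_def)
    then show ?case
      using generate.eng[OF letter[OF w(2), of b] Cons.IH[OF w(1)]] by (simp add: a presented_mult)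
  qed
  then show "carrier (presented_group S R) \<subseteq> generate (presented_group S R) (pres_gen S R ` S)"
    by (auto simp: carrier_presented)
qed

text \<open>The homomorphism sends a class to the product along any of its words, with inverses for the letters
  marked \<open>False\<close>. Only the generating steps of the congruence have to be checked, and all relators
  that occur are words without formal inverses.\<close>

lemma presented_group_universal:
  assumes H: "group H" and f: "f ` S \<subseteq> carrier H"
    and R: "\<And>l r. (l, r) \<in> R \<Longrightarrow> \<exists>xs ys. l = gens xs \<and> r = gens ys \<and>
      word_prod H f xs = word_prod H f ys"
  obtains h where "h \<in> hom (presented_group S R) H" "\<And>x. x \<in> S \<Longrightarrow> h (pres_gen S R x) = f x"
proof -
  interpret H: group H by (rule H)
  define g where "g = (\<lambda>(x, b). if b then f x else inv\<^bsub>H\<^esub> f x)"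
  have g_closed: "g ` set w \<subseteq> carrier H" if "w \<in> words S" for w
    using that f by (force simp: g_def words_def split: if_splits)
  have g_gens: "word_prod H g (gens xs) = word_prod H f xs" for xs
    by (induction xs) (auto simp: gens_def g_def)
  have eq: "word_prod H g u = word_prod H g v" if "(u, v) \<in> pres_cong S R" for u v
    using that
  proof (induction rule: pres_cong.induct)
    case (cancel u v x b)
    have x: "f x \<in> carrier H" using f cancel by blast
    have c: "set [(x, b), (x, \<not> b)] \<subseteq> S \<times> UNIV" using cancel by auto
    have "word_prod H g ([(x, b), (x, \<not> b)] @ v) = word_prod H g v"
      using x H.word_prod_closed[OF g_closed[OF cancel(2)]]
      by (cases b) (auto simp: g_def simp flip: H.m_assoc)
    moreover have "word_prod H g (u @ [(x, b), (x, \<not> b)] @ v)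
        = word_prod H g u \<otimes>\<^bsub>H\<^esub> word_prod H g ([(x, b), (x, \<not> b)] @ v)"
      by (rule H.word_prod_append; rule g_closed) (use cancel in \<open>auto simp: words_def\<close>)
    moreover have "word_prod H g (u @ v) = word_prod H g u \<otimes>\<^bsub>H\<^esub> word_prod H g v"
      by (rule H.word_prod_append; rule g_closed) (use cancel in auto)
    ultimately show ?case by simp
  next
    case (relation l r u v)
    have "word_prod H g l = word_prod H g r"
      using R[OF relation(1)] g_gens by auto
    moreover have "u \<in> words S" "v \<in> words S" "l \<in> words S" "r \<in> words S"
      using relation by (auto simp: words_append)
    ultimately show ?case
      by (simp add: H.word_prod_append[OF g_closed g_closed] words_append)
  qed auto
  define h where "h A = word_prod H g (SOME w. w \<in> A)" for A
  have h: "h (pres_cong S R `` {w}) = word_prod H g w" if "w \<in> words S" for w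
  proof -
    have "\<exists>v. v \<in> pres_cong S R `` {w}" using that by (blast intro: pres_cong.refl)
    then have "(SOME v. v \<in> pres_cong S R `` {w}) \<in> pres_cong S R `` {w}" by (rule someI_ex)
    then show ?thesis unfolding h_def using eq by simp
  qed
  have "h \<in> hom (presented_group S R) H"
    by (rule homI)
      (auto simp: carrier_presented presented_mult h words_append
        H.word_prod_append[OF g_closed g_closed] H.word_prod_closed[OF g_closed])
  moreover have "h (pres_gen S R x) = f x" if "x \<in> S" for x
    using that f h[of "[(x, True)]"] by (auto simp: pres_gen_def words_def g_def)
  ultimately show ?thesis by (rule that)
qed

section \<open>Parabolic subgroups\<close>

text \<open>Since an involution is its own inverse, a set that contains the identity and is stable under right
  multiplication by the generators contains the subgroup that they generate. All upper bounds on
  parabolic subgroups below are obtained in this way.\<close>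

lemma (in group) generate_subset_right_closed:
  assumes s: "s ` I \<subseteq> carrier G" "\<And>i. i \<in> I \<Longrightarrow> s i \<otimes> s i = \<one>"
    and X: "X \<subseteq> carrier G" "\<one> \<in> X" "\<And>x i. x \<in> X \<Longrightarrow> i \<in> I \<Longrightarrow> x \<otimes> s i \<in> X"
  shows "generate G (s ` I) \<subseteq> X"
proof -
  have "\<forall>x\<in>X. x \<otimes> h \<in> X" if "h \<in> generate G (s ` I)" for h
    using that
  proof (induction rule: generate.induct)
    case (inv h)
    then obtain i where i: "i \<in> I" "h = s i" by blast
    then have "inv h = s i" using s by (intro inv_equality) auto
    then show ?case using i X by auto
  next
    case (eng h1 h2)
    then have "h1 \<in> carrier G" "h2 \<in> carrier G"
      using generate_in_carrier[OF s(1)] by auto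
    with eng X(1) show ?case by (auto simp flip: m_assoc)
  qed (use X in auto)
  moreover have "h \<in> carrier G" if "h \<in> generate G (s ` I)" for h
    using that generate_in_carrier[OF s(1)] by blast
  ultimately show ?thesis using X(2) by (metis l_one subsetI)
qed

lemma (in group) generate_centralizes:
  assumes "S \<subseteq> carrier G" "x \<in> carrier G" "\<And>y. y \<in> S \<Longrightarrow> x \<otimes> y = y \<otimes> x"
    and "h \<in> generate G S"
  shows "x \<otimes> h = h \<otimes> x"
  using assms(4)
proof (induction rule: generate.induct)
  case (inv h)
  then have h: "h \<in> carrier G" "x \<otimes> h = h \<otimes> x" using assms by auto
  have "h \<otimes> (x \<otimes> inv h) = x" using h assms(2) by (simp add: m_assoc flip: m_assoc[of h x] h(2))
  then show ?case using h(1) assms(2) by (simp add: inv_solve_left)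
next
  case (eng h1 h2)
  then have "h1 \<in> carrier G" "h2 \<in> carrier G"
    using generate_in_carrier[OF assms(1)] by auto
  with eng assms(2) show ?case by (metis m_assoc)
qed (use assms in auto)

lemma (in group) generate_commuting_union:
  assumes s: "s ` (A \<union> B) \<subseteq> carrier G" "\<And>i. i \<in> A \<union> B \<Longrightarrow> s i \<otimes> s i = \<one>"
    and comm: "\<And>a b. a \<in> A \<Longrightarrow> b \<in> B \<Longrightarrow> s a \<otimes> s b = s b \<otimes> s a"
    and x: "x \<in> generate G (s ` (A \<union> B))"
  shows "\<exists>y z. y \<in> generate G (s ` A) \<and> z \<in> generate G (s ` B) \<and> x = y \<otimes> z"
proof -
  let ?X = "{y \<otimes> z | y z. y \<in> generate G (s ` A) \<and> z \<in> generate G (s ` B)}"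
  have A: "s ` A \<subseteq> carrier G" and B: "s ` B \<subseteq> carrier G" using s by auto
  note cl = generate_in_carrier[OF A] generate_in_carrier[OF B]
  have "generate G (s ` (A \<union> B)) \<subseteq> ?X"
  proof (rule generate_subset_right_closed)
    have "\<one> = \<one> \<otimes> \<one>" by simp
    then show "\<one> \<in> ?X" using generate.one by blast
    fix x i assume "x \<in> ?X" and i: "i \<in> A \<union> B"
    then obtain y z where yz: "y \<in> generate G (s ` A)" "z \<in> generate G (s ` B)" "x = y \<otimes> z" by blast
    note yzc = cl(1)[OF yz(1)] cl(2)[OF yz(2)]
    from i show "x \<otimes> s i \<in> ?X"
    proof
      assume i: "i \<in> A"
      then have si: "s i \<in> carrier G" using A by auto
      have "s i \<otimes> z = z \<otimes> s i"
        by (rule generate_centralizes[OF B si _ yz(2)]) (use comm i in auto)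
      then have "x \<otimes> s i = (y \<otimes> s i) \<otimes> z" using yz yzc si by (simp add: m_assoc)
      moreover have "y \<otimes> s i \<in> generate G (s ` A)"
        using yz i by (intro generate.eng) (auto intro: generate.incl)
      ultimately show ?thesis using yz(2) by blast
    next
      assume i: "i \<in> B"
      then have si: "s i \<in> carrier G" using B by auto
      have "x \<otimes> s i = y \<otimes> (z \<otimes> s i)" using yz yzc si by (simp add: m_assoc)
      moreover have "z \<otimes> s i \<in> generate G (s ` B)"
        using yz i by (intro generate.eng) (auto intro: generate.incl)
      ultimately show ?thesis using yz(1) by blast
    qed
  qed (use s cl in auto)
  with x show ?thesis by blast
qed

text \<open>Every parabolic subgroup is reached from the whole group by deleting generators one at a time, so
  it is enough to intersect with maximal parabolic subgroups.\<close>

lemma intersection_property_if_maximal: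
  fixes n :: nat
  assumes G: "group G" and s: "s ` {..<n} \<subseteq> carrier G"
    and max: "\<And>I j. I \<subseteq> {..<n} \<Longrightarrow> j < n \<Longrightarrow>
      generate G (s ` I) \<inter> generate G (s ` ({..<n} - {j})) \<subseteq> generate G (s ` (I - {j}))"
    and I: "I \<subseteq> {..<n}" and J: "J \<subseteq> {..<n}"
  shows "generate G (s ` I) \<inter> generate G (s ` J) = generate G (s ` (I \<inter> J))"
proof
  interpret group G by (rule G)
  have *: "finite K \<Longrightarrow> K \<subseteq> {..<n} - J \<Longrightarrow>
    generate G (s ` I) \<inter> generate G (s ` J) \<subseteq> generate G (s ` (I - K))" for K
  proof (induction K rule: finite_induct)
    case (insert j K)
    have "generate G (s ` J) \<subseteq> generate G (s ` ({..<n} - {j}))"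
      by (rule mono_generate) (use insert J in auto)
    then have "generate G (s ` I) \<inter> generate G (s ` J) \<subseteq> generate G (s ` (I - K - {j}))"
      using insert max[of "I - K" j] I by blast
    then show ?case by (simp add: set_diff_eq conj_ac)
  qed simp
  have "I - ({..<n} - J) = I \<inter> J" using I by auto
  then show "generate G (s ` I) \<inter> generate G (s ` J) \<subseteq> generate G (s ` (I \<inter> J))"
    using *[of "{..<n} - J"] by (simp add: finite_Diff)
  show "generate G (s ` (I \<inter> J)) \<subseteq> generate G (s ` I) \<inter> generate G (s ` J)"
    by (intro Int_greatest mono_generate image_mono) auto
qed

text \<open>A certificate for the intersection property. If an element of a maximal parabolic subgroup is
  represented by a word in the list, and each letter \<open>i\<close> of that word keeps the element out of the
  maximal parabolic subgroup without \<open>s\<^sub>i\<close>, then the letters of the word are exactly the generators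
  that every parabolic subgroup containing the element must have.\<close>

lemma intersection_property_from_words:
  fixes n :: nat
  assumes G: "group G" and s: "s ` {..<n} \<subseteq> carrier G"
    and words: "\<And>j. j < n \<Longrightarrow> set ` M j \<subseteq> Pow ({..<n} - {j})"
    and cover: "\<And>j. j < n \<Longrightarrow> generate G (s ` ({..<n} - {j})) \<subseteq> word_prod G s ` M j"
    and sep: "\<And>j w i. j < n \<Longrightarrow> w \<in> M j \<Longrightarrow> i \<in> set w \<Longrightarrow>
      word_prod G s w \<notin> generate G (s ` ({..<n} - {i}))"
    and I: "I \<subseteq> {..<n}" and J: "J \<subseteq> {..<n}"
  shows "generate G (s ` I) \<inter> generate G (s ` J) = generate G (s ` (I \<inter> J))"
proof (rule intersection_property_if_maximal[OF G s _ I J], rule subsetI)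
  interpret group G by (rule G)
  fix I j x
  assume I: "I \<subseteq> {..<n}" and j: "j < n"
    and x: "x \<in> generate G (s ` I) \<inter> generate G (s ` ({..<n} - {j}))"
  have "x \<in> word_prod G s ` M j" using x cover[OF j] by (meson IntD2 subsetD)
  then obtain w where w: "w \<in> M j" "x = word_prod G s w" by (elim imageE)
  have "i \<in> I" if "i \<in> set w" for i
  proof (rule ccontr)
    assume "i \<notin> I"
    then have "generate G (s ` I) \<subseteq> generate G (s ` ({..<n} - {i}))"
      using I by (intro mono_generate) auto
    with sep[OF j w(1) that] w(2) x show False by blast
  qed
  with words[OF j] w(1) have "set w \<subseteq> I - {j}" by blast
  then show "x \<in> generate G (s ` (I - {j}))"
    unfolding w(2) by (rule word_prod_in_generate) (use I s in auto)
qed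

section \<open>Sections below a facet and above a vertex\<close>

definition maximal_parabolic :: "('a, 'b) monoid_scheme \<Rightarrow> nat \<Rightarrow> (nat \<Rightarrow> 'a) \<Rightarrow> nat \<Rightarrow> 'a set" where
  "maximal_parabolic G n s i = generate G (s ` ({..<n} - {i}))"

text \<open>This is the statement that faces of a section which are incident in the whole polytope are
  incident already inside the section. A maximal parabolic subgroup is the product of two commuting
  parts, generated by the \<open>s\<^sub>k\<close> with \<open>k\<close> below and above the missing index. One part of one factor lies in
  the other factor, and the remaining part lies in the group of the section because \<open>e\<close> is an
  extreme index.\<close>

lemma parabolic_product_intersection:
  assumes W: "string_C_group W n s"
    and e: "e = 0 \<or> e = n - 1" and e_n: "e < n" and ab: "a \<noteq> e" "b \<noteq> e" "a \<le> b" "b < n"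
    and p: "p \<in> maximal_parabolic W n s a" and q: "q \<in> maximal_parabolic W n s b"
    and pq: "p \<otimes>\<^bsub>W\<^esub> q \<in> maximal_parabolic W n s e"
  obtains p' q' where "p' \<in> maximal_parabolic W n s a \<inter> maximal_parabolic W n s e"
    "q' \<in> maximal_parabolic W n s b \<inter> maximal_parabolic W n s e" "p \<otimes>\<^bsub>W\<^esub> q = p' \<otimes>\<^bsub>W\<^esub> q'"
proof -
  from W interpret group W by (simp add: string_C_group_def)
  have s: "s ` I \<subseteq> carrier W" "\<And>i. i \<in> I \<Longrightarrow> s i \<otimes>\<^bsub>W\<^esub> s i = \<one>\<^bsub>W\<^esub>" if "I \<subseteq> {..<n}" for I
    using W that by (auto simp: string_C_group_def)
  have comm: "s i \<otimes>\<^bsub>W\<^esub> s j = s j \<otimes>\<^bsub>W\<^esub> s i" if "i < c" "c < j" "j < n" for i j c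
    using W that by (auto simp: string_C_group_def)
  have subg: "subgroup (maximal_parabolic W n s i) W" for i
    unfolding maximal_parabolic_def by (rule generate_is_subgroup) (rule s, auto)
  note sub = subgroup.subset[OF subg, THEN subsetD]
  have mono: "x \<in> generate W (s ` I) \<Longrightarrow> I \<subseteq> {..<n} - {i} \<Longrightarrow> x \<in> maximal_parabolic W n s i" for x I i
    unfolding maximal_parabolic_def using mono_generate[of "s ` I" "s ` ({..<n} - {i})"] by blast
  have split1: "\<exists>y z. y \<in> generate W (s ` {..<c}) \<and> z \<in> generate W (s ` {c<..<n}) \<and> x = y \<otimes>\<^bsub>W\<^esub> z"
    and split2: "\<exists>y z. y \<in> generate W (s ` {c<..<n}) \<and> z \<in> generate W (s ` {..<c}) \<and> x = y \<otimes>\<^bsub>W\<^esub> z"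
    if "x \<in> maximal_parabolic W n s c" "c < n" for x c
  proof -
    have sub_n: "{..<c} \<union> {c<..<n} \<subseteq> {..<n}" "{c<..<n} \<union> {..<c} \<subseteq> {..<n}" using that(2) by auto
    have eq: "{..<n} - {c} = {..<c} \<union> {c<..<n}" using that by auto
    show "\<exists>y z. y \<in> generate W (s ` {..<c}) \<and> z \<in> generate W (s ` {c<..<n}) \<and> x = y \<otimes>\<^bsub>W\<^esub> z"
      using that(1) unfolding maximal_parabolic_def eq
      by (rule generate_commuting_union[rotated -1])
        (use s[of "{..<c} \<union> {c<..<n}"] sub_n that(2) comm in auto)
    have eq: "{..<n} - {c} = {c<..<n} \<union> {..<c}" using that by auto
    show "\<exists>y z. y \<in> generate W (s ` {c<..<n}) \<and> z \<in> generate W (s ` {..<c}) \<and> x = y \<otimes>\<^bsub>W\<^esub> z"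
      using that(1) unfolding maximal_parabolic_def eq
      by (rule generate_commuting_union[rotated -1])
        (use s[of "{c<..<n} \<union> {..<c}"] sub_n that(2) comm[symmetric] in auto)
  qed
  let ?D = "maximal_parabolic W n s"
  show ?thesis
  proof (cases "a = b")
    case True
    then have "p \<otimes>\<^bsub>W\<^esub> q \<in> ?D a \<inter> ?D e"
      using p q pq subgroup.m_closed[OF subg] by blast
    then show ?thesis
      using that[of "p \<otimes>\<^bsub>W\<^esub> q" "\<one>\<^bsub>W\<^esub>"] subgroup.one_closed[OF subg] sub by auto
  next
    case False
    with ab have ab': "a < b" by simp
    from e show ?thesis
    proof
      assume e0: "e = 0"
      from split2[OF p] ab obtain y z where
        yz: "y \<in> generate W (s ` {a<..<n})" "z \<in> generate W (s ` {..<a})" "p = y \<otimes>\<^bsub>W\<^esub> z" by auto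
      have ya: "y \<in> ?D a" by (rule mono[OF yz(1)]) auto
      have ye: "y \<in> ?D e" by (rule mono[OF yz(1)]) (use e0 in auto)
      have zb: "z \<in> ?D b" by (rule mono[OF yz(2)]) (use ab' ab in auto)
      have c: "y \<in> carrier W" "z \<in> carrier W" "q \<in> carrier W" using ya zb q sub by auto
      have eq: "p \<otimes>\<^bsub>W\<^esub> q = y \<otimes>\<^bsub>W\<^esub> (z \<otimes>\<^bsub>W\<^esub> q)" using c yz by (simp add: m_assoc)
      have "z \<otimes>\<^bsub>W\<^esub> q = inv\<^bsub>W\<^esub> y \<otimes>\<^bsub>W\<^esub> (p \<otimes>\<^bsub>W\<^esub> q)" unfolding eq using c by (simp flip: m_assoc)
      then have "z \<otimes>\<^bsub>W\<^esub> q \<in> ?D e"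
        using pq ye subgroup.m_closed[OF subg] subgroup.m_inv_closed[OF subg] by simp
      then show ?thesis
        using that[of y "z \<otimes>\<^bsub>W\<^esub> q"] eq ya ye zb q subgroup.m_closed[OF subg] by blast
    next
      assume e1: "e = n - 1"
      from split2[OF q] ab obtain y z where
        yz: "y \<in> generate W (s ` {b<..<n})" "z \<in> generate W (s ` {..<b})" "q = y \<otimes>\<^bsub>W\<^esub> z" by auto
      have ya: "y \<in> ?D a" by (rule mono[OF yz(1)]) (use ab' in auto)
      have zb: "z \<in> ?D b" by (rule mono[OF yz(2)]) (use ab in auto)
      have ze: "z \<in> ?D e" by (rule mono[OF yz(2)]) (use e1 ab in auto)
      have c: "y \<in> carrier W" "z \<in> carrier W" "p \<in> carrier W" using ya zb p sub by auto
      have eq: "p \<otimes>\<^bsub>W\<^esub> q = (p \<otimes>\<^bsub>W\<^esub> y) \<otimes>\<^bsub>W\<^esub> z" using c yz by (simp add: m_assoc)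
      have "p \<otimes>\<^bsub>W\<^esub> y = (p \<otimes>\<^bsub>W\<^esub> q) \<otimes>\<^bsub>W\<^esub> inv\<^bsub>W\<^esub> z" unfolding eq using c by (simp add: m_assoc)
      then have "p \<otimes>\<^bsub>W\<^esub> y \<in> ?D e"
        using pq ze subgroup.m_closed[OF subg] subgroup.m_inv_closed[OF subg] by simp
      then show ?thesis
        using that[of "p \<otimes>\<^bsub>W\<^esub> y" z] eq ya ze zb p subgroup.m_closed[OF subg] by blast
    qed
  qed
qed

text \<open>The sections below a facet and above a vertex are treated together: \<open>d = 0, e = m\<close> is the facet
  \<open>H\<^sub>m w\<close>, and \<open>d = 1, e = 0\<close> is the vertex \<open>H\<^sub>0 w\<close>. The group of the section is \<open>H\<^sub>e\<close>, and \<open>h\<close> maps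
  a group \<open>C\<close> with generators \<open>t\<^sub>0, \<dots>, t\<^sub>m\<^sub>-\<^sub>1\<close> onto it. The kernel of \<open>h\<close> may be nontrivial, so that
  the polytope of \<open>C\<close> covers the section.\<close>

locale polytope_section =
  fixes W :: "('a, 'b) monoid_scheme" and C :: "('c, 'd) monoid_scheme"
    and s :: "nat \<Rightarrow> 'a" and t :: "nat \<Rightarrow> 'c" and m d e :: nat and h :: "'c \<Rightarrow> 'a" and w :: 'a
  assumes W: "string_C_group W (Suc m) s" and C: "group C"
    and t: "t ` {..<m} \<subseteq> carrier C" "generate C (t ` {..<m}) = carrier C"
    and h: "h \<in> hom C W" and ht: "\<And>i. i < m \<Longrightarrow> h (t i) = s (i + d)"
    and de: "d = 0 \<and> e = m \<or> d = 1 \<and> e = 0"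
    and w: "w \<in> carrier W"
begin

sublocale W: group W using W by (simp add: string_C_group_def)
sublocale C: group C by (rule C)
sublocale h: group_hom C W h by unfold_locales (rule h)

abbreviation "HW \<equiv> maximal_parabolic W (Suc m) s"
abbreviation "HC \<equiv> maximal_parabolic C m t"
abbreviation "P \<equiv> polytope W (Suc m) s"
abbreviation "PC \<equiv> polytope C m t"
abbreviation "ker \<equiv> kernel C W h"

lemma s_carrier: "i < Suc m \<Longrightarrow> s i \<in> carrier W"
  using W by (simp add: string_C_group_def)

lemma subgroup_HW: "subgroup (HW i) W"
  unfolding maximal_parabolic_def by (rule W.generate_is_subgroup) (auto intro: s_carrier)

lemma subgroup_HC: "subgroup (HC i) C"
  unfolding maximal_parabolic_def by (rule C.generate_is_subgroup) (use t in auto)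

lemma h_image_generate: "I \<subseteq> {..<m} \<Longrightarrow> h ` generate C (t ` I) = generate W (s ` ((\<lambda>i. i + d) ` I))"
proof -
  assume I: "I \<subseteq> {..<m}"
  have "h ` t ` I = s ` (\<lambda>i. i + d) ` I"
    unfolding image_image by (rule image_cong) (use I ht in auto)
  moreover have "t ` I \<subseteq> carrier C" using I t(1) by blast
  ultimately show ?thesis using h.generate_img[of "t ` I"] by simp
qed

lemma shift_image: "(\<lambda>i. i + d) ` {..<m} = {..<Suc m} - {e}"
proof -
  have "Suc ` {..<m} = {..<Suc m} - {0}"
    unfolding lessThan_Suc_eq_insert_0 by (simp add: inj_image_mem_iff)
  moreover have "{..<m} = {..<Suc m} - {m}" by auto
  moreover have "(\<lambda>i. i + 1) ` {..<m} = Suc ` {..<m}" by simp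
  ultimately show ?thesis using de by (elim disjE conjE) simp_all
qed

lemma h_image_carrier: "h ` carrier C = HW e"
  using h_image_generate[of "{..<m}"] t by (simp add: shift_image maximal_parabolic_def)

lemma h_in_HW: "u \<in> carrier C \<Longrightarrow> h u \<in> HW e"
  using h_image_carrier by blast

lemma h_image_HC: "i < m \<Longrightarrow> h ` HC i = HW (i + d) \<inter> HW e"
proof -
  assume i: "i < m"
  have inj: "inj (\<lambda>i. i + d)" by simp
  have "(\<lambda>i. i + d) ` ({..<m} - {i}) = ({..<Suc m} - {i + d}) \<inter> ({..<Suc m} - {e})"
    using shift_image image_set_diff[OF inj, of "{..<m}" "{i}"] by auto
  moreover have "generate W (s ` ({..<Suc m} - {i + d})) \<inter> generate W (s ` ({..<Suc m} - {e}))
    = generate W (s ` (({..<Suc m} - {i + d}) \<inter> ({..<Suc m} - {e})))"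
  proof -
    have "\<forall>I J. I \<subseteq> {..<Suc m} \<and> J \<subseteq> {..<Suc m} \<longrightarrow>
      generate W (s ` I) \<inter> generate W (s ` J) = generate W (s ` (I \<inter> J))"
      using W unfolding string_C_group_def by (elim conjE)
    then show ?thesis by (elim allE impE) auto
  qed
  ultimately show ?thesis
    unfolding maximal_parabolic_def by (subst h_image_generate) auto
qed

text \<open>Cancelling \<open>w\<close>, a common element of the two cosets writes \<open>h u (h v)\<inverse>\<close>, which lies in \<open>H\<^sub>e\<close>, as a
  product of elements of two maximal parabolic subgroups. The factors can be chosen in \<open>H\<^sub>e\<close> and hence
  lift to \<open>C\<close>, up to an element of the kernel.\<close>

lemma cosets_meet:
  assumes ij: "i \<le> j" "j < m" and u: "u \<in> carrier C" and v: "v \<in> carrier C"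
  shows "(HW (i + d) #>\<^bsub>W\<^esub> (h u \<otimes>\<^bsub>W\<^esub> w)) \<inter> (HW (j + d) #>\<^bsub>W\<^esub> (h v \<otimes>\<^bsub>W\<^esub> w)) \<noteq> {}
    \<longleftrightarrow> (\<exists>k\<in>ker. (HC i #>\<^bsub>C\<^esub> u) \<inter> (HC j #>\<^bsub>C\<^esub> (v \<otimes>\<^bsub>C\<^esub> k)) \<noteq> {})"
    (is "?L \<longleftrightarrow> ?R")
proof
  note subW = subgroup.subset[OF subgroup_HW, THEN subsetD]
  note subC = subgroup.subset[OF subgroup_HC, THEN subsetD]
  assume ?L
  then obtain a b where ab: "a \<in> HW (i + d)" "b \<in> HW (j + d)"
    "a \<otimes>\<^bsub>W\<^esub> (h u \<otimes>\<^bsub>W\<^esub> w) = b \<otimes>\<^bsub>W\<^esub> (h v \<otimes>\<^bsub>W\<^esub> w)"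
    by (auto simp: r_coset_def)
  have c: "a \<in> carrier W" "b \<in> carrier W" using ab subW by auto
  have "a \<otimes>\<^bsub>W\<^esub> h u = b \<otimes>\<^bsub>W\<^esub> h v"
    using ab(3) c u v w by (metis W.m_assoc W.m_closed W.right_cancel h.hom_closed)
  then have "h u = inv\<^bsub>W\<^esub> a \<otimes>\<^bsub>W\<^esub> (b \<otimes>\<^bsub>W\<^esub> h v)"
    using c u v by (simp add: W.inv_solve_left)
  then have eq: "h (u \<otimes>\<^bsub>C\<^esub> inv\<^bsub>C\<^esub> v) = inv\<^bsub>W\<^esub> a \<otimes>\<^bsub>W\<^esub> b"
    using c u v by (simp add: W.inv_solve_right' W.m_assoc)
  have abe: "inv\<^bsub>W\<^esub> a \<otimes>\<^bsub>W\<^esub> b \<in> HW e" using eq h_in_HW[of "u \<otimes>\<^bsub>C\<^esub> inv\<^bsub>C\<^esub> v"] u v by simp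
  have a': "inv\<^bsub>W\<^esub> a \<in> HW (i + d)" using ab subgroup.m_inv_closed[OF subgroup_HW] by blast
  obtain p' q' where pq: "p' \<in> HW (i + d) \<inter> HW e" "q' \<in> HW (j + d) \<inter> HW e"
    "inv\<^bsub>W\<^esub> a \<otimes>\<^bsub>W\<^esub> b = p' \<otimes>\<^bsub>W\<^esub> q'"
    by (rule parabolic_product_intersection[OF W, of e "i + d" "j + d" "inv\<^bsub>W\<^esub> a" b, rotated -1])
      (use ab abe a' ij de in auto)
  obtain p q where p: "p \<in> HC i" "p' = h p" and q: "q \<in> HC j" "q' = h q"
    using pq h_image_HC ij by (metis imageE le_less_trans)
  have pc: "p \<in> carrier C" "q \<in> carrier C" using p q subC by auto
  define k where "k = inv\<^bsub>C\<^esub> (q \<otimes>\<^bsub>C\<^esub> v) \<otimes>\<^bsub>C\<^esub> (inv\<^bsub>C\<^esub> p \<otimes>\<^bsub>C\<^esub> u)"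
  have kc: "k \<in> carrier C" using pc u v by (simp add: k_def)
  have uv: "h u \<otimes>\<^bsub>W\<^esub> inv\<^bsub>W\<^esub> h v = h p \<otimes>\<^bsub>W\<^esub> h q" using eq pq p q u v by simp
  then have "h u = h p \<otimes>\<^bsub>W\<^esub> (h q \<otimes>\<^bsub>W\<^esub> h v)"
    using pc u v by (metis W.inv_solve_right W.m_assoc W.m_closed h.hom_closed)
  then have "h (q \<otimes>\<^bsub>C\<^esub> v) = h (inv\<^bsub>C\<^esub> p \<otimes>\<^bsub>C\<^esub> u)"
    using pc u v by (simp add: W.inv_solve_left)
  then have "k \<in> ker" using kc pc u v unfolding kernel_def k_def by simp
  moreover have "inv\<^bsub>C\<^esub> p \<otimes>\<^bsub>C\<^esub> u = q \<otimes>\<^bsub>C\<^esub> (v \<otimes>\<^bsub>C\<^esub> k)"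
    using pc u v unfolding k_def by (simp add: C.inv_mult_group flip: C.m_assoc)
  then have "inv\<^bsub>C\<^esub> p \<otimes>\<^bsub>C\<^esub> u \<in> (HC i #>\<^bsub>C\<^esub> u) \<inter> (HC j #>\<^bsub>C\<^esub> (v \<otimes>\<^bsub>C\<^esub> k))"
    using p q subgroup.m_inv_closed[OF subgroup_HC] unfolding r_coset_def by force
  ultimately show ?R by blast
next
  note subC = subgroup.subset[OF subgroup_HC, THEN subsetD]
  assume ?R
  then obtain k a b where k: "k \<in> ker" and ab: "a \<in> HC i" "b \<in> HC j"
    "a \<otimes>\<^bsub>C\<^esub> u = b \<otimes>\<^bsub>C\<^esub> (v \<otimes>\<^bsub>C\<^esub> k)"
    by (auto simp: r_coset_def)
  have c: "a \<in> carrier C" "b \<in> carrier C" "k \<in> carrier C" "h k = \<one>\<^bsub>W\<^esub>"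
    using ab subC k by (auto simp: kernel_def)
  have "h a \<in> HW (i + d)" "h b \<in> HW (j + d)" using ab h_image_HC[of i] h_image_HC[of j] ij by auto
  moreover have "h a \<otimes>\<^bsub>W\<^esub> (h u \<otimes>\<^bsub>W\<^esub> w) = h b \<otimes>\<^bsub>W\<^esub> (h v \<otimes>\<^bsub>W\<^esub> w)"
    using arg_cong[OF ab(3), of h] c u v w by (simp flip: W.m_assoc)
  ultimately show ?L unfolding r_coset_def by blast
qed

definition bottom :: "'a face" where
  "bottom = (if d = 0 then Least_Face else Coset_Face 0 (HW 0 #>\<^bsub>W\<^esub> w))"

definition top :: "'a face" where
  "top = (if d = 0 then Coset_Face m (HW m #>\<^bsub>W\<^esub> w) else Greatest_Face)"

definition "section =
  (if d = 0 then section_below P (Coset_Face e (HW e #>\<^bsub>W\<^esub> w))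
   else section_above P (Coset_Face e (HW e #>\<^bsub>W\<^esub> w)))"

text \<open>The face \<open>T\<^sub>i u\<close> goes to \<open>H\<^sub>i\<^sub>+\<^sub>d h(u) w\<close>, and the two improper faces go to the ends of the section,
  one of which is the base facet or base vertex itself. The choice of \<open>u\<close> in the coset is immaterial.\<close>

fun to_section :: "'c face \<Rightarrow> 'a face" where
  "to_section Least_Face = bottom"
| "to_section Greatest_Face = top"
| "to_section (Coset_Face i D) =
    Coset_Face (i + d) (HW (i + d) #>\<^bsub>W\<^esub> (h (SOME u. u \<in> D) \<otimes>\<^bsub>W\<^esub> w))"

lemma to_section_coset:
  assumes i: "i < m" and u: "u \<in> carrier C"
  shows "to_section (Coset_Face i (HC i #>\<^bsub>C\<^esub> u)) = Coset_Face (i + d) (HW (i + d) #>\<^bsub>W\<^esub> (h u \<otimes>\<^bsub>W\<^esub> w))"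
proof -
  note subC = subgroup.subset[OF subgroup_HC, THEN subsetD]
  have "u \<in> HC i #>\<^bsub>C\<^esub> u" using C.rcos_self[OF u subgroup_HC] .
  then have "(SOME v. v \<in> HC i #>\<^bsub>C\<^esub> u) \<in> HC i #>\<^bsub>C\<^esub> u" by (rule someI)
  then obtain a where a: "a \<in> HC i" "(SOME v. v \<in> HC i #>\<^bsub>C\<^esub> u) = a \<otimes>\<^bsub>C\<^esub> u"
    by (auto simp: r_coset_def)
  have "h a \<in> HW (i + d)" using a h_image_HC[OF i] by auto
  then have "h (a \<otimes>\<^bsub>C\<^esub> u) \<otimes>\<^bsub>W\<^esub> w \<in> HW (i + d) #>\<^bsub>W\<^esub> (h u \<otimes>\<^bsub>W\<^esub> w)"
    using subC[OF a(1)] u w unfolding r_coset_def by (auto simp: W.m_assoc)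
  then have "HW (i + d) #>\<^bsub>W\<^esub> (h u \<otimes>\<^bsub>W\<^esub> w) = HW (i + d) #>\<^bsub>W\<^esub> (h (a \<otimes>\<^bsub>C\<^esub> u) \<otimes>\<^bsub>W\<^esub> w)"
    by (rule W.repr_independence[OF _ _ subgroup_HW]) (use u w in auto)
  then show ?thesis by (simp add: a(2))
qed

lemma carrier_PC: "x \<in> carrier PC \<longleftrightarrow> x = Least_Face \<or> x = Greatest_Face \<or>
    (\<exists>i<m. \<exists>u\<in>carrier C. x = Coset_Face i (HC i #>\<^bsub>C\<^esub> u))"
  by (auto simp: polytope_def proper_faces_def RCOSETS_def maximal_parabolic_def)

lemma carrier_P: "x \<in> carrier P \<longleftrightarrow> x = Least_Face \<or> x = Greatest_Face \<or>
    (\<exists>i<Suc m. \<exists>u\<in>carrier W. x = Coset_Face i (HW i #>\<^bsub>W\<^esub> u))"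
  by (auto simp: polytope_def proper_faces_def RCOSETS_def maximal_parabolic_def)

lemma coset_of_image_meets_base:
  assumes u: "u \<in> carrier C"
  shows "(HW i #>\<^bsub>W\<^esub> (h u \<otimes>\<^bsub>W\<^esub> w)) \<inter> (HW e #>\<^bsub>W\<^esub> w) \<noteq> {}"
proof -
  have "h u \<otimes>\<^bsub>W\<^esub> w \<in> HW i #>\<^bsub>W\<^esub> (h u \<otimes>\<^bsub>W\<^esub> w)"
    by (rule W.rcos_self[OF _ subgroup_HW]) (use u w in auto)
  moreover have "h u \<otimes>\<^bsub>W\<^esub> w \<in> HW e #>\<^bsub>W\<^esub> w"
    using h_in_HW[OF u] by (auto simp: r_coset_def)
  ultimately show ?thesis by blast
qed

lemma coset_meeting_base:
  assumes v: "v \<in> carrier W" and meet: "(HW i #>\<^bsub>W\<^esub> v) \<inter> (HW e #>\<^bsub>W\<^esub> w) \<noteq> {}"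
  shows "\<exists>u\<in>carrier C. HW i #>\<^bsub>W\<^esub> v = HW i #>\<^bsub>W\<^esub> (h u \<otimes>\<^bsub>W\<^esub> w)"
proof -
  from meet obtain y where y: "y \<in> HW i #>\<^bsub>W\<^esub> v" "y \<in> HW e #>\<^bsub>W\<^esub> w" by blast
  from y(2) obtain p where p: "p \<in> HW e" "y = p \<otimes>\<^bsub>W\<^esub> w" by (auto simp: r_coset_def)
  from p(1) obtain u where "u \<in> carrier C" "p = h u" unfolding h_image_carrier[symmetric] by blast
  with p(2) have "u \<in> carrier C" "y = h u \<otimes>\<^bsub>W\<^esub> w" by simp_all
  with W.repr_independence[OF y(1) v subgroup_HW] show ?thesis by blast
qed

lemma base_self: "(HW e #>\<^bsub>W\<^esub> w) \<inter> (HW e #>\<^bsub>W\<^esub> w) \<noteq> {}"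
  using W.rcos_self[OF w subgroup_HW] by blast

lemma base_eq:
  assumes v: "v \<in> carrier W" and meet: "(HW e #>\<^bsub>W\<^esub> v) \<inter> (HW e #>\<^bsub>W\<^esub> w) \<noteq> {}"
  shows "HW e #>\<^bsub>W\<^esub> v = HW e #>\<^bsub>W\<^esub> w"
  using meet W.repr_independence[OF _ v subgroup_HW] W.repr_independence[OF _ w subgroup_HW] by blast

lemma carrier_section:
  "y \<in> carrier section \<longleftrightarrow> y \<in> carrier P \<and>
    (if d = 0 then face_le y (Coset_Face e (HW e #>\<^bsub>W\<^esub> w))
     else face_le (Coset_Face e (HW e #>\<^bsub>W\<^esub> w)) y)"
  by (simp add: section_def section_below_def section_above_def polytope_def)

lemma ends_in_section: "bottom \<in> carrier section" "top \<in> carrier section"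
proof -
  have e: "Coset_Face e (HW e #>\<^bsub>W\<^esub> w) \<in> carrier P"
    unfolding carrier_P using de w by (intro disjI2 exI[of _ e]) auto
  have "Least_Face \<in> carrier P" "Greatest_Face \<in> carrier P" by (simp_all add: carrier_P)
  with e base_self de show "bottom \<in> carrier section" "top \<in> carrier section"
    unfolding carrier_section bottom_def top_def by (elim disjE conjE; simp)+
qed

lemma to_section_image: "to_section ` carrier PC = carrier section"
proof
  show "to_section ` carrier PC \<subseteq> carrier section"
  proof
    fix y assume "y \<in> to_section ` carrier PC"
    then obtain x where x: "x \<in> carrier PC" "y = to_section x" by blast
    from x(1)[unfolded carrier_PC] show "y \<in> carrier section"
    proof (elim disjE exE bexE conjE)
      fix i u assume iu: "i < m" "u \<in> carrier C" "x = Coset_Face i (HC i #>\<^bsub>C\<^esub> u)"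
      have y: "y = Coset_Face (i + d) (HW (i + d) #>\<^bsub>W\<^esub> (h u \<otimes>\<^bsub>W\<^esub> w))"
        using iu x to_section_coset by simp
      have "y \<in> carrier P"
        unfolding carrier_P y using iu de w by (intro disjI2 exI[of _ "i + d"]) auto
      then show ?thesis
        using coset_of_image_meets_base[OF iu(2), of "i + d"] de iu(1) unfolding carrier_section y
        by (auto simp: Int_commute)
    qed (use x ends_in_section in simp_all)
  qed
  show "carrier section \<subseteq> to_section ` carrier PC"
  proof
    fix y assume y: "y \<in> carrier section"
    have coset: "Coset_Face i (HW i #>\<^bsub>W\<^esub> v) \<in> to_section ` carrier PC"
      if v: "v \<in> carrier W" and meet: "(HW i #>\<^bsub>W\<^esub> v) \<inter> (HW e #>\<^bsub>W\<^esub> w) \<noteq> {}"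
        and iv: "i < Suc m" "i \<noteq> e" for i v
    proof -
      obtain u where u: "u \<in> carrier C" "HW i #>\<^bsub>W\<^esub> v = HW i #>\<^bsub>W\<^esub> (h u \<otimes>\<^bsub>W\<^esub> w)"
        using coset_meeting_base[OF v meet] by (elim bexE)
      have i: "i - d < m" "i - d + d = i" using iv de by auto
      then have "to_section (Coset_Face (i - d) (HC (i - d) #>\<^bsub>C\<^esub> u)) = Coset_Face i (HW i #>\<^bsub>W\<^esub> v)"
        using to_section_coset[OF i(1) u(1)] u(2) by simp
      moreover have "Coset_Face (i - d) (HC (i - d) #>\<^bsub>C\<^esub> u) \<in> carrier PC"
        using i(1) u(1) by (auto simp: carrier_PC)
      ultimately show ?thesis by (metis imageI)
    qed
    have ends: "bottom \<in> to_section ` carrier PC" "top \<in> to_section ` carrier PC"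
      by (auto simp: carrier_PC image_iff intro: bexI[of _ Least_Face] bexI[of _ Greatest_Face])
    have yP: "y \<in> carrier P"
      and le: "if d = 0 then face_le y (Coset_Face e (HW e #>\<^bsub>W\<^esub> w))
        else face_le (Coset_Face e (HW e #>\<^bsub>W\<^esub> w)) y"
      using y by (simp_all add: carrier_section)
    from yP[unfolded carrier_P] show "y \<in> to_section ` carrier PC"
    proof (elim disjE exE bexE conjE)
      fix i v assume iv: "i < Suc m" "v \<in> carrier W" "y = Coset_Face i (HW i #>\<^bsub>W\<^esub> v)"
      have meet: "(HW i #>\<^bsub>W\<^esub> v) \<inter> (HW e #>\<^bsub>W\<^esub> w) \<noteq> {}"
        using le iv(3) by (auto simp: Int_commute split: if_splits)
      show ?thesis
      proof (cases "i = e")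
        case True
        with meet base_eq[OF iv(2)] have "y = Coset_Face e (HW e #>\<^bsub>W\<^esub> w)" using iv(3) by simp
        then show ?thesis using ends de by (auto simp: bottom_def top_def)
      next
        case False
        with coset[OF iv(2) meet iv(1)] iv(3) show ?thesis by simp
      qed
    qed (use ends le de in \<open>auto simp: bottom_def top_def\<close>)
  qed
qed

lemma one_ker: "\<one>\<^bsub>C\<^esub> \<in> ker" by (simp add: kernel_def)

lemma face_action_coset:
  assumes "u \<in> carrier C" "k \<in> carrier C"
  shows "face_action C k (Coset_Face i (HC i #>\<^bsub>C\<^esub> u)) = Coset_Face i (HC i #>\<^bsub>C\<^esub> (u \<otimes>\<^bsub>C\<^esub> k))"
  using assms C.coset_mult_assoc[OF subgroup.subset[OF subgroup_HC]] by simp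

lemma ker_carrier: "k \<in> ker \<Longrightarrow> k \<in> carrier C" by (simp add: kernel_def)

lemma to_section_le:
  assumes x: "x \<in> carrier PC" and y: "y \<in> carrier PC"
  shows "face_le (to_section x) (to_section y) \<longleftrightarrow> (\<exists>k\<in>ker. face_le x (face_action C k y))"
proof -
  have ex: "ker \<noteq> {}" using one_ker by blast
  have coset_le: "face_le (Coset_Face (i + d) (HW (i + d) #>\<^bsub>W\<^esub> (h u \<otimes>\<^bsub>W\<^esub> w))) top"
    "face_le bottom (Coset_Face (i + d) (HW (i + d) #>\<^bsub>W\<^esub> (h u \<otimes>\<^bsub>W\<^esub> w)))"
    "\<not> face_le (Coset_Face (i + d) (HW (i + d) #>\<^bsub>W\<^esub> (h u \<otimes>\<^bsub>W\<^esub> w))) bottom"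
    "\<not> face_le top (Coset_Face (i + d) (HW (i + d) #>\<^bsub>W\<^esub> (h u \<otimes>\<^bsub>W\<^esub> w)))"
    if "i < m" "u \<in> carrier C" for i u
    using that de coset_of_image_meets_base[OF that(2), of "i + d"] by (auto simp: bottom_def top_def Int_commute)
  have ends: "face_le bottom top" "face_le bottom bottom" "face_le top top" "\<not> face_le top bottom"
    using de base_self by (auto simp: bottom_def top_def)
  from x[unfolded carrier_PC] y[unfolded carrier_PC] show ?thesis
  proof (elim disjE exE bexE conjE)
    fix i u j v
    assume iu: "i < m" "u \<in> carrier C" "x = Coset_Face i (HC i #>\<^bsub>C\<^esub> u)"
      and jv: "j < m" "v \<in> carrier C" "y = Coset_Face j (HC j #>\<^bsub>C\<^esub> v)"
    have "(\<exists>k\<in>ker. face_le x (face_action C k y)) \<longleftrightarrow>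
      i \<le> j \<and> (\<exists>k\<in>ker. (HC i #>\<^bsub>C\<^esub> u) \<inter> (HC j #>\<^bsub>C\<^esub> (v \<otimes>\<^bsub>C\<^esub> k)) \<noteq> {})"
      using iu(3) jv face_action_coset[OF jv(2) ker_carrier] by auto
    also have "\<dots> \<longleftrightarrow> i \<le> j \<and> (HW (i + d) #>\<^bsub>W\<^esub> (h u \<otimes>\<^bsub>W\<^esub> w)) \<inter> (HW (j + d) #>\<^bsub>W\<^esub> (h v \<otimes>\<^bsub>W\<^esub> w)) \<noteq> {}"
      using cosets_meet iu jv by blast
    also have "\<dots> \<longleftrightarrow> face_le (to_section x) (to_section y)"
      using iu jv to_section_coset by simp
    finally show ?thesis by simp
  qed (use ex coset_le ends to_section_coset in \<open>auto\<close>)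
qed

lemma to_section_eq:
  assumes x: "x \<in> carrier PC" and y: "y \<in> carrier PC" and eq: "to_section x = to_section y"
  shows "\<exists>k\<in>ker. x = face_action C k y"
proof -
  have ex: "ker \<noteq> {}" using one_ker by blast
  have ends: "bottom \<noteq> top" "top \<noteq> bottom"
    "\<And>i A. i < m \<Longrightarrow> bottom \<noteq> Coset_Face (i + d) A"
    "\<And>i A. i < m \<Longrightarrow> top \<noteq> Coset_Face (i + d) A"
    "\<And>i A. i < m \<Longrightarrow> Coset_Face (i + d) A \<noteq> bottom"
    "\<And>i A. i < m \<Longrightarrow> Coset_Face (i + d) A \<noteq> top"
    using de by (auto simp: bottom_def top_def)
  from x[unfolded carrier_PC] y[unfolded carrier_PC] show ?thesis
  proof (elim disjE exE bexE conjE)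
    fix i u j v
    assume iu: "i < m" "u \<in> carrier C" "x = Coset_Face i (HC i #>\<^bsub>C\<^esub> u)"
      and jv: "j < m" "v \<in> carrier C" "y = Coset_Face j (HC j #>\<^bsub>C\<^esub> v)"
    have ij: "i = j" and cosets: "HW (i + d) #>\<^bsub>W\<^esub> (h u \<otimes>\<^bsub>W\<^esub> w) = HW (i + d) #>\<^bsub>W\<^esub> (h v \<otimes>\<^bsub>W\<^esub> w)"
      using eq iu jv to_section_coset by auto
    have "h u \<otimes>\<^bsub>W\<^esub> w \<in> HW (i + d) #>\<^bsub>W\<^esub> (h u \<otimes>\<^bsub>W\<^esub> w)"
      by (rule W.rcos_self[OF _ subgroup_HW]) (use iu w in auto)
    then obtain k where k: "k \<in> ker" "(HC i #>\<^bsub>C\<^esub> u) \<inter> (HC i #>\<^bsub>C\<^esub> (v \<otimes>\<^bsub>C\<^esub> k)) \<noteq> {}"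
      using cosets_meet[of i i u v] iu jv cosets by blast
    have "v \<otimes>\<^bsub>C\<^esub> k \<in> carrier C" using jv(2) ker_carrier[OF k(1)] by simp
    with k(2) have "HC i #>\<^bsub>C\<^esub> u = HC i #>\<^bsub>C\<^esub> (v \<otimes>\<^bsub>C\<^esub> k)"
      using C.repr_independence[OF _ _ subgroup_HC] iu(2) by blast
    then show ?thesis
      using k(1) iu(3) jv ij face_action_coset[OF jv(2) ker_carrier[OF k(1)]] by auto
  qed (use ex ends eq to_section_coset in \<open>auto\<close>)
qed

lemma section_le: "x \<sqsubseteq>\<^bsub>section\<^esub> y \<longleftrightarrow> face_le x y" "x' \<sqsubseteq>\<^bsub>PC\<^esub> y' \<longleftrightarrow> face_le x' y'"
  by (auto simp: section_def section_below_def section_above_def polytope_def)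

lemma face_action_one:
  assumes "x \<in> carrier PC"
  shows "face_action C \<one>\<^bsub>C\<^esub> x = x"
  using assms face_action_coset[OF _ C.one_closed] by (auto simp: carrier_PC)

lemma face_action_ker_closed:
  assumes "k \<in> ker" "x \<in> carrier PC"
  shows "face_action C k x \<in> carrier PC"
  using assms(2)[unfolded carrier_PC]
proof (elim disjE exE bexE conjE)
  fix i u assume iu: "i < m" "u \<in> carrier C" "x = Coset_Face i (HC i #>\<^bsub>C\<^esub> u)"
  have "u \<otimes>\<^bsub>C\<^esub> k \<in> carrier C" using iu(2) ker_carrier[OF assms(1)] by simp
  then show ?thesis
    unfolding iu(3) face_action_coset[OF iu(2) ker_carrier[OF assms(1)]] carrier_PC
    using iu(1) by blast
qed (simp_all add: carrier_PC)

lemma to_section_face_action: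
  assumes k: "k \<in> ker" and x: "x \<in> carrier PC"
  shows "to_section (face_action C k x) = to_section x"
  using x[unfolded carrier_PC]
proof (elim disjE exE bexE conjE)
  fix i u assume iu: "i < m" "u \<in> carrier C" "x = Coset_Face i (HC i #>\<^bsub>C\<^esub> u)"
  have "h (u \<otimes>\<^bsub>C\<^esub> k) = h u" using iu(2) k by (auto simp: kernel_def)
  then show ?thesis
    using iu ker_carrier[OF k] face_action_coset[OF iu(2) ker_carrier[OF k]] to_section_coset by simp
qed auto

end

lemma poset_isomorphic_sym:
  assumes "poset_isomorphic L M"
  shows "poset_isomorphic M L"
proof -
  from assms obtain f where f: "bij_betw f (carrier L) (carrier M)"
    "\<And>x y. x \<in> carrier L \<Longrightarrow> y \<in> carrier L \<Longrightarrow> x \<sqsubseteq>\<^bsub>L\<^esub> y \<longleftrightarrow> f x \<sqsubseteq>\<^bsub>M\<^esub> f y"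
    unfolding poset_isomorphic_def by blast
  let ?g = "inv_into (carrier L) f"
  have "bij_betw ?g (carrier M) (carrier L)" using bij_betw_inv_into[OF f(1)] .
  moreover have "x \<sqsubseteq>\<^bsub>M\<^esub> y \<longleftrightarrow> ?g x \<sqsubseteq>\<^bsub>L\<^esub> ?g y" if "x \<in> carrier M" "y \<in> carrier M" for x y
    using that f(2)[of "?g x" "?g y"] bij_betwE[OF calculation] bij_betw_inv_into_right[OF f(1)] by auto
  ultimately show ?thesis unfolding poset_isomorphic_def by blast
qed

context polytope_section
begin

lemma section_isomorphic:
  assumes "ker = {\<one>\<^bsub>C\<^esub>}"
  shows "poset_isomorphic section PC"
proof (rule poset_isomorphic_sym)
  have "inj_on to_section (carrier PC)"
    using to_section_eq assms by (auto simp: inj_on_def face_action_one)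
  then have "bij_betw to_section (carrier PC) (carrier section)"
    using to_section_image by (simp add: bij_betw_def)
  moreover have "x \<sqsubseteq>\<^bsub>PC\<^esub> y \<longleftrightarrow> to_section x \<sqsubseteq>\<^bsub>section\<^esub> to_section y" if "x \<in> carrier PC" "y \<in> carrier PC" for x y
    using that to_section_le[OF that] assms by (simp add: section_le face_action_one)
  ultimately show "poset_isomorphic PC section" unfolding poset_isomorphic_def by blast
qed

text \<open>The fibres of the map onto the section are the orbits of the kernel, and two faces of the section
  are incident if and only if some faces in the fibres are.\<close>

lemma section_isomorphic_quotient:
  assumes ker: "ker = {\<one>\<^bsub>C\<^esub>, c}"
  shows "poset_isomorphic section (quotient_poset PC (face_action C c))"
proof (rule poset_isomorphic_sym)
  let ?o = "cyclic_orbit (face_action C c)"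
  let ?Q = "quotient_poset PC (face_action C c)"
  have c: "c \<in> ker" using ker by blast
  have pow: "(face_action C c ^^ k) x \<in> carrier PC \<and> to_section ((face_action C c ^^ k) x) = to_section x"
    if "x \<in> carrier PC" for k x
    using that by (induction k) (auto simp: face_action_ker_closed[OF c] to_section_face_action[OF c])
  have orbit: "y \<in> carrier PC" "to_section y = to_section x" if "y \<in> ?o x" "x \<in> carrier PC" for x y
    using that pow by (auto simp: cyclic_orbit_def)
  have self: "x \<in> ?o x" for x unfolding cyclic_orbit_def by (auto intro: exI[of _ 0])
  have act: "face_action C k x \<in> ?o x" if "k \<in> ker" "x \<in> carrier PC" for k x
    using that self[of x] ker face_action_one[OF that(2)]
    by (auto simp: cyclic_orbit_def intro: exI[of _ 1])
  have step: "?o (face_action C c x) \<subseteq> ?o x" for x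
  proof
    fix y assume "y \<in> ?o (face_action C c x)"
    then obtain k where "y = (face_action C c ^^ k) (face_action C c x)"
      by (auto simp: cyclic_orbit_def)
    then have "y = (face_action C c ^^ Suc k) x" by (simp only: funpow_Suc_right o_apply)
    then show "y \<in> ?o x" unfolding cyclic_orbit_def by blast
  qed
  have orbit_sub: "?o x \<subseteq> ?o y" if "x \<in> carrier PC" "y \<in> carrier PC" "to_section x = to_section y" for x y
    using to_section_eq[OF that] ker step[of y] face_action_one[OF that(2)] by auto
  have orbit_eq: "?o x = ?o y \<longleftrightarrow> to_section x = to_section y" if "x \<in> carrier PC" "y \<in> carrier PC" for x y
    using orbit_sub that orbit(2)[of x y] self[of x] by (metis subset_antisym)
  define f where "f A = to_section (SOME x. x \<in> A)" for A
  have f: "f (?o x) = to_section x" if "x \<in> carrier PC" for x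
    using orbit(2)[OF someI[of "\<lambda>y. y \<in> ?o x", OF self] that] by (simp add: f_def)
  have carrier: "carrier ?Q = ?o ` carrier PC" by (simp add: quotient_poset_def)
  have "bij_betw f (carrier ?Q) (carrier section)"
    unfolding bij_betw_def carrier
    using f orbit_eq to_section_image by (auto simp: inj_on_def image_image)
  moreover have "A \<sqsubseteq>\<^bsub>?Q\<^esub> B \<longleftrightarrow> f A \<sqsubseteq>\<^bsub>section\<^esub> f B" if AB: "A \<in> carrier ?Q" "B \<in> carrier ?Q" for A B
  proof -
    obtain x y where x: "x \<in> carrier PC" "A = ?o x" and y: "y \<in> carrier PC" "B = ?o y"
      using AB unfolding carrier by (elim imageE) blast
    have "A \<sqsubseteq>\<^bsub>?Q\<^esub> B \<longleftrightarrow> (\<exists>x'\<in>?o x. \<exists>y'\<in>?o y. face_le x' y')"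
      using x y by (simp add: quotient_poset_def section_le)
    also have "\<dots> \<longleftrightarrow> face_le (to_section x) (to_section y)"
    proof
      assume "\<exists>x'\<in>?o x. \<exists>y'\<in>?o y. face_le x' y'"
      then obtain x' y' where xy: "x' \<in> ?o x" "y' \<in> ?o y" "face_le x' y'" by blast
      have "face_le (to_section x') (to_section y')"
        using xy(3) one_ker orbit(1)[OF xy(1) x(1)] orbit(1)[OF xy(2) y(1)]
        by (auto simp: to_section_le face_action_one intro!: bexI[of _ "\<one>\<^bsub>C\<^esub>"])
      then show "face_le (to_section x) (to_section y)"
        using orbit(2)[OF xy(1) x(1)] orbit(2)[OF xy(2) y(1)] by simp
    next
      assume "face_le (to_section x) (to_section y)"
      then show "\<exists>x'\<in>?o x. \<exists>y'\<in>?o y. face_le x' y'"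
        using to_section_le[OF x(1) y(1)] self[of x] act[OF _ y(1)] by blast
    qed
    finally show ?thesis using f x y by (simp add: section_le)
  qed
  ultimately show "poset_isomorphic ?Q section" unfolding poset_isomorphic_def by blast
qed

end

section \<open>Normal forms in the Coxeter group\<close>

text \<open>The shortlex normal forms of the Coxeter group \<open>[5, 3]\<close>: the 10 elements of the dihedral group
  \<open>\<langle>t\<^sub>0, t\<^sub>1\<rangle>\<close> times the 12 minimal representatives of its right cosets, which correspond to the faces of
  the dodecahedron.\<close>

definition dihedral_words :: "nat list list" where
  "dihedral_words = [[], [0], [1], [0,1], [1,0], [0,1,0], [1,0,1], [0,1,0,1], [1,0,1,0], [0,1,0,1,0]]"

definition coset_words :: "nat list list" where
  "coset_words = [[], [2], [2,1], [2,1,0], [2,1,0,1], [2,1,0,1,0], [2,1,0,1,2], [2,1,0,1,0,2],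
     [2,1,0,1,0,2,1], [2,1,0,1,0,2,1,0], [2,1,0,1,0,2,1,0,1], [2,1,0,1,0,2,1,0,1,2]]"

definition H3_words :: "nat list list" where
  "H3_words = [u @ v. u \<leftarrow> dihedral_words, v \<leftarrow> coset_words]"

lemma dihedral_letters: "u \<in> set dihedral_words \<Longrightarrow> set u \<subseteq> {..<2}"
  by (auto simp: dihedral_words_def)

lemma coset_letters: "v \<in> set coset_words \<Longrightarrow> set v \<subseteq> {..<3}"
  by (auto simp: coset_words_def)

lemma H3_letters: "w \<in> set H3_words \<Longrightarrow> set w \<subseteq> {..<3}"
  using dihedral_letters coset_letters by (fastforce simp: H3_words_def)

text \<open>The elements of \<open>\<langle>t\<^sub>3\<rangle> \<times> \<langle>t\<^sub>0, t\<^sub>1\<rangle>\<close>, which is the group of a pentagonal prism.\<close>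

definition prism_words :: "nat list list" where
  "prism_words = [u @ v. u \<leftarrow> [[], [3]], v \<leftarrow> dihedral_words]"

lemmas word_list_eval = list.set ball_simps bex_simps append.simps word_prod_Nil word_prod_Cons simp_thms

lemma (in group) relator_cancel:
  assumes "word_prod G t w = \<one>" "t ` set w \<subseteq> carrier G" "x \<in> carrier G"
  shows "foldr (\<lambda>i x. t i \<otimes> x) w x = x"
proof -
  have "foldr (\<lambda>i x. t i \<otimes> x) w x = word_prod G t w \<otimes> x"
    using assms(2,3) by (induction w) (auto simp: m_assoc word_prod_closed)
  with assms show ?thesis by simp
qed

locale dihedral5 = group G for G (structure) +
  fixes t :: "nat \<Rightarrow> 'a"
  assumes t01: "t 0 \<in> carrier G" "t 1 \<in> carrier G"
    and sq01: "t 0 \<otimes> t 0 = \<one>" "t 1 \<otimes> t 1 = \<one>"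
    and rel01: "word_prod G t [0,1,0,1,0,1,0,1,0,1] = \<one>"
begin

lemma cancel01:
  assumes "x \<in> carrier G"
  shows "t 0 \<otimes> (t 0 \<otimes> x) = x" "t 1 \<otimes> (t 1 \<otimes> x) = x"
  using assms t01 sq01 by (simp_all flip: m_assoc)

lemma braid01:
  assumes x: "x \<in> carrier G"
  shows "t 1 \<otimes> (t 0 \<otimes> (t 1 \<otimes> (t 0 \<otimes> (t 1 \<otimes> x)))) = t 0 \<otimes> (t 1 \<otimes> (t 0 \<otimes> (t 1 \<otimes> (t 0 \<otimes> x))))"
proof -
  have "t 0 \<otimes> (t 1 \<otimes> (t 0 \<otimes> (t 1 \<otimes> (t 0 \<otimes> x)))) =
    t 0 \<otimes> (t 1 \<otimes> (t 0 \<otimes> (t 1 \<otimes> (t 0 \<otimes> foldr (\<lambda>i x. t i \<otimes> x) [0,1,0,1,0,1,0,1,0,1] x))))"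
    using relator_cancel[OF rel01 _ x] t01 by simp
  then show ?thesis using x t01 cancel01 by simp
qed

lemmas rewrite01 = cancel01 braid01

lemma dihedral_words_closed:
  "u \<in> set dihedral_words \<Longrightarrow> i < 2 \<Longrightarrow> word_prod G t (u @ [i]) \<in> word_prod G t ` set dihedral_words"
proof -
  have "\<forall>u\<in>set dihedral_words. \<forall>i\<in>{0,1}. \<exists>u'\<in>set dihedral_words. word_prod G t (u @ [i]) = word_prod G t u'"
    unfolding dihedral_words_def by (simp only: word_list_eval rewrite01 t01 m_closed one_closed)
  moreover assume "u \<in> set dihedral_words" "i < 2"
  ultimately show ?thesis by (auto simp: less_2_cases_iff)
qed

lemma dihedral_cover: "generate G (t ` {..<2}) \<subseteq> word_prod G t ` set dihedral_words"
proof (rule generate_subset_right_closed)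
  have t: "t ` {..<2} \<subseteq> carrier G" using t01 by (auto simp: less_2_cases_iff)
  then show "t ` {..<2} \<subseteq> carrier G" .
  show "t i \<otimes> t i = \<one>" if "i \<in> {..<2}" for i using that sq01 by (auto simp: less_2_cases_iff)
  show "word_prod G t ` set dihedral_words \<subseteq> carrier G"
    using dihedral_letters t by (force intro: word_prod_closed)
  show "\<one> \<in> word_prod G t ` set dihedral_words"
    by (auto simp: dihedral_words_def)
  fix x i assume "x \<in> word_prod G t ` set dihedral_words" "i \<in> {..<2::nat}"
  then obtain u where u: "u \<in> set dihedral_words" "x = word_prod G t u" and i: "i < 2" by auto
  have "t ` set u \<subseteq> carrier G" "t ` set [i] \<subseteq> carrier G" using dihedral_letters[OF u(1)] i t by auto
  then have "x \<otimes> t i = word_prod G t (u @ [i])"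
    using word_prod_append[of t u "[i]"] by (simp add: u(2))
  then show "x \<otimes> t i \<in> word_prod G t ` set dihedral_words"
    using dihedral_words_closed[OF u(1) i] by simp
qed

end

lemma (in dihedral5) prism_cover:
  assumes t3: "t 3 \<in> carrier G" "t 3 \<otimes> t 3 = \<one>"
    and comm: "t 3 \<otimes> t 0 = t 0 \<otimes> t 3" "t 3 \<otimes> t 1 = t 1 \<otimes> t 3"
  shows "generate G (t ` ({3} \<union> {..<2})) \<subseteq> word_prod G t ` set prism_words"
proof
  fix x assume x: "x \<in> generate G (t ` ({3} \<union> {..<2}))"
  have t: "t ` {..<2} \<subseteq> carrier G" using t01 by (auto simp: less_2_cases_iff)
  have "\<exists>y z. y \<in> generate G (t ` {3}) \<and> z \<in> generate G (t ` {..<2}) \<and> x = y \<otimes> z"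
    by (rule generate_commuting_union[OF _ _ _ x])
      (use t t3 comm sq01 in \<open>auto simp: less_2_cases_iff\<close>)
  then obtain y z where y: "y \<in> generate G (t ` {3})" and z: "z \<in> generate G (t ` {..<2})"
    and yz: "x = y \<otimes> z" by blast
  have "generate G (t ` {3}) \<subseteq> word_prod G t ` {[], [3]}"
    by (rule generate_subset_right_closed) (use t3 in auto)
  with y obtain u where u: "u \<in> {[], [3]}" "y = word_prod G t u" by blast
  from z dihedral_cover obtain v where v: "v \<in> set dihedral_words" "z = word_prod G t v" by blast
  have "t ` set u \<subseteq> carrier G" "t ` set v \<subseteq> carrier G"
    using u t3 t dihedral_letters[OF v(1)] by auto
  then have "x = word_prod G t (u @ v)" by (simp add: yz u v word_prod_append)
  then show "x \<in> word_prod G t ` set prism_words"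
    using u v by (auto simp: prism_words_def)
qed

locale H3_relations = dihedral5 +
  assumes t2: "t 2 \<in> carrier G" and sq2: "t 2 \<otimes> t 2 = \<one>"
    and rel12: "word_prod G t [1,2,1,2,1,2] = \<one>"
    and comm02: "t 2 \<otimes> t 0 = t 0 \<otimes> t 2"
begin

text \<open>Together with the three rules for \<open>t\<^sub>0\<close> and \<open>t\<^sub>1\<close> these are the minimal rules that rewrite a word to
  its shortlex normal form. The last three come from critical pairs: each equates the two
  results of reducing one word in two ways by the earlier rules or the relations.\<close>

lemma rewrite2:
  assumes x: "x \<in> carrier G"
  shows "t 2 \<otimes> (t 2 \<otimes> x) = x"
    and "t 2 \<otimes> (t 0 \<otimes> x) = t 0 \<otimes> (t 2 \<otimes> x)"
    and "t 2 \<otimes> (t 1 \<otimes> (t 2 \<otimes> x)) = t 1 \<otimes> (t 2 \<otimes> (t 1 \<otimes> x))"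
    and "t 2 \<otimes> (t 1 \<otimes> (t 0 \<otimes> (t 2 \<otimes> x))) = t 1 \<otimes> (t 2 \<otimes> (t 1 \<otimes> (t 0 \<otimes> x)))"
    and "t 2 \<otimes> (t 1 \<otimes> (t 0 \<otimes> (t 1 \<otimes> (t 2 \<otimes> (t 1 \<otimes> x)))))
       = t 1 \<otimes> (t 2 \<otimes> (t 1 \<otimes> (t 0 \<otimes> (t 1 \<otimes> (t 2 \<otimes> x)))))"
    and "t 2 \<otimes> (t 1 \<otimes> (t 0 \<otimes> (t 1 \<otimes> (t 0 \<otimes> (t 2 \<otimes> (t 1 \<otimes> (t 0 \<otimes> (t 1 \<otimes> (t 0 \<otimes> x)))))))))
       = t 1 \<otimes> (t 2 \<otimes> (t 1 \<otimes> (t 0 \<otimes> (t 1 \<otimes> (t 0 \<otimes> (t 2 \<otimes> (t 1 \<otimes> (t 0 \<otimes> (t 1 \<otimes> x)))))))))"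
proof -
  note cl = t01 t2
  have cancel: "t 2 \<otimes> (t 2 \<otimes> x) = x" if "x \<in> carrier G" for x
    using that t2 sq2 by (simp flip: m_assoc)
  have comm: "t 2 \<otimes> (t 0 \<otimes> x) = t 0 \<otimes> (t 2 \<otimes> x)" if "x \<in> carrier G" for x
    using that cl comm02 by (simp flip: m_assoc)
  have braid: "t 2 \<otimes> (t 1 \<otimes> (t 2 \<otimes> x)) = t 1 \<otimes> (t 2 \<otimes> (t 1 \<otimes> x))" if "x \<in> carrier G" for x
  proof -
    have "t 1 \<otimes> (t 2 \<otimes> (t 1 \<otimes> x)) = t 1 \<otimes> (t 2 \<otimes> (t 1 \<otimes> foldr (\<lambda>i x. t i \<otimes> x) [1,2,1,2,1,2] x))"
      using relator_cancel[OF rel12 _ that] cl by simp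
    then show ?thesis using that cl cancel cancel01 by simp
  qed
  have braid2: "t 2 \<otimes> (t 1 \<otimes> (t 0 \<otimes> (t 2 \<otimes> x))) = t 1 \<otimes> (t 2 \<otimes> (t 1 \<otimes> (t 0 \<otimes> x)))"
    if "x \<in> carrier G" for x
    using that cl braid[of "t 0 \<otimes> x"] comm[of x] by simp
  from x show "t 2 \<otimes> (t 2 \<otimes> x) = x" "t 2 \<otimes> (t 0 \<otimes> x) = t 0 \<otimes> (t 2 \<otimes> x)"
    "t 2 \<otimes> (t 1 \<otimes> (t 2 \<otimes> x)) = t 1 \<otimes> (t 2 \<otimes> (t 1 \<otimes> x))"
    "t 2 \<otimes> (t 1 \<otimes> (t 0 \<otimes> (t 2 \<otimes> x))) = t 1 \<otimes> (t 2 \<otimes> (t 1 \<otimes> (t 0 \<otimes> x)))"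
    by (fact cancel comm braid braid2)+
  show "t 2 \<otimes> (t 1 \<otimes> (t 0 \<otimes> (t 1 \<otimes> (t 2 \<otimes> (t 1 \<otimes> x)))))
       = t 1 \<otimes> (t 2 \<otimes> (t 1 \<otimes> (t 0 \<otimes> (t 1 \<otimes> (t 2 \<otimes> x)))))"
    using x cl braid2[of "t 1 \<otimes> (t 2 \<otimes> x)"] braid[of x] by simp
  show "t 2 \<otimes> (t 1 \<otimes> (t 0 \<otimes> (t 1 \<otimes> (t 0 \<otimes> (t 2 \<otimes> (t 1 \<otimes> (t 0 \<otimes> (t 1 \<otimes> (t 0 \<otimes> x)))))))))
       = t 1 \<otimes> (t 2 \<otimes> (t 1 \<otimes> (t 0 \<otimes> (t 1 \<otimes> (t 0 \<otimes> (t 2 \<otimes> (t 1 \<otimes> (t 0 \<otimes> (t 1 \<otimes> x)))))))))"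
    (is "?l = _")
  proof -
    \<comment> \<open>Commute the second 2 to the left, then read the braid relation of 0 and 1 backwards.\<close>
    have "?l = t 2 \<otimes> (t 1 \<otimes> (t 0 \<otimes> (t 1 \<otimes> (t 2 \<otimes> (t 0 \<otimes> (t 1 \<otimes> (t 0 \<otimes> (t 1 \<otimes> (t 0 \<otimes> x)))))))))"
      by (simp only: comm m_closed cl x)
    also have "\<dots> = t 2 \<otimes> (t 1 \<otimes> (t 0 \<otimes> (t 1 \<otimes> (t 2 \<otimes> (t 1 \<otimes> (t 0 \<otimes> (t 1 \<otimes> (t 0 \<otimes> (t 1 \<otimes> x)))))))))"
      using x by (simp only: braid01)
    also have "\<dots> = t 2 \<otimes> (t 1 \<otimes> (t 0 \<otimes> (t 2 \<otimes> (t 1 \<otimes> (t 2 \<otimes> (t 0 \<otimes> (t 1 \<otimes> (t 0 \<otimes> (t 1 \<otimes> x)))))))))"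
      by (simp only: braid m_closed cl x)
    also have "\<dots> = t 1 \<otimes> (t 2 \<otimes> (t 1 \<otimes> (t 0 \<otimes> (t 1 \<otimes> (t 2 \<otimes> (t 0 \<otimes> (t 1 \<otimes> (t 0 \<otimes> (t 1 \<otimes> x)))))))))"
      by (simp only: braid2 m_closed cl x)
    finally show ?thesis by (simp only: comm m_closed cl x)
  qed
qed

lemmas H3_rewrite = rewrite01 rewrite2 t01 t2 m_closed one_closed

text \<open>The coset table of \<open>\<langle>t\<^sub>0, t\<^sub>1\<rangle>\<close> in \<open>[5, 3]\<close>. The prefix \<open>p\<close> is the Schreier correction, which is at most
  one letter for these representatives.\<close>

lemma coset_words_closed:
  assumes "v \<in> set coset_words" "i < 3"
  shows "\<exists>p\<in>{[], [0], [1]}. \<exists>v'\<in>set coset_words. word_prod G t (v @ [i]) = word_prod G t (p @ v')"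
proof -
  have "\<forall>v\<in>set coset_words. \<forall>i\<in>{0,1,2}. \<exists>p\<in>{[], [0], [1]}. \<exists>v'\<in>set coset_words.
    word_prod G t (v @ [i]) = word_prod G t (p @ v')"
    unfolding coset_words_def by (simp only: word_list_eval H3_rewrite)
  with assms show ?thesis by (auto simp: less_Suc_eq numeral_3_eq_3 numeral_2_eq_2)
qed

lemma t_carrier: "t ` {..<3} \<subseteq> carrier G"
  using t01 t2 by (auto simp: less_Suc_eq numeral_3_eq_3 numeral_2_eq_2)

lemma letters_carrier: "set u \<subseteq> {..<3} \<Longrightarrow> t ` set u \<subseteq> carrier G"
  using t_carrier by blast

lemma H3_cover: "generate G (t ` {..<3}) \<subseteq> word_prod G t ` set H3_words"
proof (rule generate_subset_right_closed)
  show "t ` {..<3} \<subseteq> carrier G" by (rule t_carrier)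
  show "t i \<otimes> t i = \<one>" if "i \<in> {..<3}" for i
    using that sq01 sq2 by (auto simp: less_Suc_eq numeral_3_eq_3 numeral_2_eq_2)
  show "word_prod G t ` set H3_words \<subseteq> carrier G"
    using H3_letters t_carrier by (force intro: word_prod_closed)
  show "\<one> \<in> word_prod G t ` set H3_words"
    by (auto simp: H3_words_def dihedral_words_def coset_words_def)
  fix x i assume "x \<in> word_prod G t ` set H3_words" "i \<in> {..<3::nat}"
  then obtain u v where uv: "u \<in> set dihedral_words" "v \<in> set coset_words"
    and x: "x = word_prod G t (u @ v)" and i: "i < 3" by (auto simp: H3_words_def)
  obtain p v' where p: "p \<in> {[], [0], [1]}" and v': "v' \<in> set coset_words"
    "word_prod G t (v @ [i]) = word_prod G t (p @ v')"
    using coset_words_closed[OF uv(2) i] by blast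
  have cl: "t ` set u \<subseteq> carrier G" "t ` set v \<subseteq> carrier G" "t ` set [i] \<subseteq> carrier G"
    "t ` set p \<subseteq> carrier G" "t ` set v' \<subseteq> carrier G"
    by (rule letters_carrier;
        use dihedral_letters[OF uv(1)] coset_letters[OF uv(2)] coset_letters[OF v'(1)] i p in fastforce)+
  have "\<exists>u'\<in>set dihedral_words. word_prod G t (u @ p) = word_prod G t u'"
    using p uv(1) dihedral_words_closed[OF uv(1), of 0] dihedral_words_closed[OF uv(1), of 1] by auto
  then obtain u' where u': "u' \<in> set dihedral_words" "word_prod G t (u @ p) = word_prod G t u'" by blast
  have cu': "t ` set u' \<subseteq> carrier G" using dihedral_letters[OF u'(1)] by (intro letters_carrier) fastforce
  have "x \<otimes> t i = word_prod G t u \<otimes> word_prod G t (v @ [i])"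
    using cl by (simp add: x word_prod_append word_prod_closed m_assoc)
  also have "\<dots> = word_prod G t (u @ p) \<otimes> word_prod G t v'"
    using cl by (simp only: v' word_prod_append word_prod_closed m_assoc)
  also have "\<dots> = word_prod G t (u' @ v')"
    using cl cu' by (simp add: u'(2) word_prod_append)
  finally show "x \<otimes> t i \<in> word_prod G t ` set H3_words"
    using u'(1) v'(1) by (auto simp: H3_words_def intro!: imageI)
qed

text \<open>The longest element is the fifth power of the Coxeter element. It represents the antipodal symmetry,
  and it is killed by the extra relation of the hemi-icosahedron.\<close>

lemma H3_longest:
  "word_prod G t [0,1,2,0,1,2,0,1,2,0,1,2,0,1,2] = word_prod G t [0,1,0,1,0,2,1,0,1,0,2,1,0,1,2]"
  by (simp only: word_list_eval H3_rewrite)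

end

section \<open>A permutation representation\<close>

text \<open>Row \<open>i\<close> lists the images of \<open>1, \<dots>, 266\<close> under the generator \<open>s\<^sub>i\<close>. The four permutations generate the
  sporadic simple group \<open>J\<^sub>1\<close> in its action on the 266 cosets of a subgroup \<open>L\<^sub>2(11)\<close>. The points are
  numbered in order of their distance from the point that is fixed by \<open>s\<^sub>1, s\<^sub>2, s\<^sub>3\<close>.\<close>

definition J1_table :: "nat list list" where
  "J1_table =
    [[2, 1, 4, 3, 7, 6, 5, 11, 9, 13, 8, 16, 10, 14, 18, 12, 22, 15, 19, 23, 28, 17, 20, 32, 25,
     34, 31, 21, 38, 40, 27, 24, 44, 26, 47, 42, 48, 29, 50, 30, 52, 36, 53, 33, 56, 57, 35, 37,
     60, 39, 63, 41, 43, 66, 67, 45, 46, 71, 72, 49, 76, 78, 51, 79, 80, 54, 55, 84, 85, 89, 58,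
     59, 91, 92, 95, 61, 97, 62, 64, 65, 102, 103, 106, 68, 69, 108, 111, 110, 70, 115, 73, 74,
     117, 119, 75, 124, 77, 128, 127, 100, 130, 81, 82, 132, 134, 83, 137, 86, 140, 88, 87, 144,
     142, 114, 90, 148, 93, 152, 94, 155, 151, 154, 147, 96, 160, 163, 99, 98, 129, 101, 166,
     104, 169, 105, 171, 165, 107, 173, 167, 109, 175, 113, 178, 112, 181, 146, 123, 116, 177,
     186, 121, 118, 190, 122, 120, 188, 194, 183, 176, 125, 197, 196, 126, 199, 136, 131, 139,
     202, 133, 204, 135, 201, 138, 207, 141, 159, 149, 143, 210, 211, 145, 182, 158, 214, 193,
     150, 218, 156, 203, 153, 223, 220, 185, 157, 227, 162, 161, 229, 164, 231, 172, 168, 189,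
     170, 234, 237, 174, 238, 239, 179, 180, 242, 243, 184, 217, 226, 215, 187, 247, 192, 232,
     233, 191, 248, 253, 216, 195, 257, 198, 254, 200, 221, 222, 205, 260, 252, 206, 208, 209,
     241, 240, 212, 213, 246, 263, 244, 219, 224, 264, 258, 259, 236, 225, 230, 265, 266, 228,
     250, 251, 235, 262, 261, 245, 249, 255, 256],
     [1, 3, 2, 6, 5, 4, 10, 8, 13, 7, 15, 17, 9, 18, 11, 21, 12, 14, 24, 26, 16, 29, 30, 19, 33,
     20, 35, 37, 22, 23, 41, 43, 25, 46, 27, 42, 28, 48, 39, 51, 31, 36, 32, 55, 45, 34, 59, 38,
     58, 62, 40, 65, 53, 64, 44, 70, 63, 49, 47, 75, 73, 50, 57, 54, 52, 83, 67, 81, 87, 56, 90,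
     80, 61, 82, 60, 96, 98, 100, 101, 72, 68, 74, 66, 107, 109, 99, 69, 112, 114, 71, 116, 118,
     120, 105, 123, 76, 126, 77, 86, 78, 79, 131, 133, 127, 94, 136, 84, 139, 85, 141, 143, 88,
     121, 89, 147, 91, 150, 92, 153, 93, 113, 157, 95, 159, 161, 97, 104, 164, 158, 165, 102,
     168, 103, 170, 162, 106, 173, 166, 108, 174, 110, 177, 111, 180, 156, 179, 115, 176, 184,
     117, 187, 189, 119, 192, 193, 145, 122, 129, 124, 195, 125, 135, 198, 128, 130, 138, 202,
     132, 203, 134, 206, 172, 137, 140, 209, 148, 142, 207, 146, 144, 194, 212, 201, 149, 215,
     217, 151, 220, 152, 222, 224, 154, 155, 181, 160, 213, 228, 163, 229, 226, 183, 167, 169,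
     233, 235, 171, 178, 208, 175, 241, 239, 182, 196, 218, 185, 245, 186, 214, 248, 188, 232,
     190, 252, 191, 254, 200, 256, 197, 199, 249, 255, 221, 204, 253, 205, 244, 261, 242, 211,
     240, 210, 238, 262, 236, 216, 247, 246, 219, 230, 258, 263, 223, 234, 225, 231, 227, 266,
     250, 265, 264, 237, 243, 251, 260, 259, 257],
     [1, 2, 5, 7, 3, 9, 4, 12, 6, 13, 16, 8, 10, 19, 20, 11, 17, 23, 14, 15, 26, 22, 18, 30, 25,
     21, 36, 34, 39, 24, 42, 40, 45, 28, 41, 27, 49, 50, 29, 32, 35, 31, 54, 56, 33, 58, 52, 60,
     37, 38, 64, 47, 66, 43, 69, 44, 71, 46, 74, 48, 77, 75, 79, 51, 82, 53, 85, 86, 55, 87, 57,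
     92, 93, 59, 62, 97, 61, 95, 63, 103, 104, 65, 83, 108, 67, 68, 70, 113, 111, 101, 117, 72,
     73, 122, 78, 125, 76, 120, 127, 129, 90, 132, 80, 81, 135, 106, 138, 84, 109, 142, 89, 145,
     88, 146, 130, 149, 91, 133, 154, 98, 156, 94, 158, 160, 96, 161, 99, 155, 100, 115, 167,
     102, 118, 171, 105, 172, 173, 107, 166, 140, 176, 110, 179, 181, 112, 114, 183, 177, 116,
     184, 188, 169, 191, 119, 128, 121, 162, 123, 175, 124, 126, 157, 197, 200, 201, 139, 131,
     202, 152, 205, 134, 136, 137, 208, 159, 141, 148, 210, 143, 213, 144, 182, 147, 150, 216,
     214, 219, 151, 221, 223, 153, 224, 226, 196, 209, 194, 163, 230, 231, 164, 165, 168, 232,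
     234, 170, 235, 238, 174, 195, 178, 243, 240, 180, 186, 244, 185, 246, 247, 187, 248, 189,
     251, 190, 192, 255, 193, 239, 249, 254, 198, 199, 203, 259, 204, 206, 245, 260, 207, 227,
     212, 242, 241, 211, 215, 236, 217, 218, 220, 228, 258, 222, 263, 265, 229, 225, 262, 264,
     250, 233, 237, 266, 256, 252, 257, 253, 261],
     [1, 2, 3, 4, 8, 6, 11, 5, 14, 15, 7, 17, 18, 9, 10, 22, 12, 13, 25, 27, 29, 16, 31, 33, 19,
     35, 20, 38, 21, 41, 23, 44, 24, 47, 26, 42, 48, 28, 45, 52, 30, 36, 55, 32, 39, 59, 34, 37,
     61, 56, 65, 40, 67, 68, 43, 50, 72, 73, 46, 76, 49, 70, 80, 81, 51, 84, 53, 54, 88, 62, 91,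
     57, 58, 94, 96, 60, 99, 89, 102, 63, 64, 105, 107, 66, 110, 98, 112, 69, 78, 116, 71, 119,
     121, 74, 124, 75, 127, 86, 77, 114, 131, 79, 134, 126, 82, 137, 83, 128, 141, 85, 144, 87,
     120, 100, 148, 90, 151, 153, 92, 113, 93, 156, 159, 95, 162, 104, 97, 108, 129, 166, 101,
     163, 170, 103, 161, 173, 106, 165, 164, 175, 109, 155, 180, 111, 157, 182, 176, 115, 185,
     187, 117, 190, 118, 188, 142, 122, 145, 158, 123, 196, 135, 125, 132, 139, 138, 130, 199,
     198, 204, 133, 197, 172, 136, 209, 140, 147, 193, 211, 212, 143, 194, 146, 183, 215, 149,
     218, 150, 154, 222, 152, 225, 220, 177, 181, 213, 160, 171, 168, 167, 226, 201, 229, 233,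
     169, 236, 228, 239, 240, 174, 242, 178, 179, 195, 217, 184, 231, 214, 186, 249, 192, 250,
     189, 253, 254, 191, 200, 243, 206, 202, 248, 216, 258, 203, 252, 244, 205, 257, 241, 207,
     208, 238, 210, 227, 235, 255, 260, 264, 230, 219, 221, 259, 234, 223, 224, 245, 262, 237,
     232, 251, 246, 266, 256, 265, 247, 263, 261]]"

definition J1_perm :: "nat \<Rightarrow> nat \<Rightarrow> nat" where
  "J1_perm i p = (if p \<in> {1..266} then J1_table ! i ! (p - 1) else p)"

definition points :: "nat list" where
  "points = [1..<267]"

lemma set_points: "set points = {1..266}"
  by (auto simp: points_def)

lemma points_list: "points = 1 # [2..<267]"
  unfolding points_def by (subst upt_conv_Cons) (simp_all del: upt_rec_numeral add: numeral_2_eq_2)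

lemmas points_expanded = points_list[simplified]

lemma J1_perm_map:
  assumes "i < 4"
  shows "map (J1_perm i) points = J1_table ! i"
proof (rule nth_equalityI)
  have "\<forall>xs\<in>set J1_table. length xs = 266" by (simp add: J1_table_def)
  moreover have "length J1_table = 4" by (simp add: J1_table_def)
  ultimately have "length (J1_table ! i) = 266" using assms nth_mem[of i J1_table] by simp
  then show "length (map (J1_perm i) points) = length (J1_table ! i)" by (simp add: points_def)
  show "map (J1_perm i) points ! k = J1_table ! i ! k" if "k < length (map (J1_perm i) points)" for k
    using that by (simp add: J1_perm_def points_def)
qed

lemmas J1_perm_values =
  J1_perm_map[of 0, unfolded J1_table_def points_expanded, simplified]
  J1_perm_map[of 1, unfolded J1_table_def points_expanded, simplified]
  J1_perm_map[of 2, unfolded J1_table_def points_expanded, simplified]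
  J1_perm_map[of 3, unfolded J1_table_def points_expanded, simplified]

definition W_relators :: "(nat list \<times> nat list) list" where
  "W_relators = [([0,0], []), ([1,1], []), ([2,2], []), ([3,3], []),
     ([0,1,0,1,0,1,0,1,0,1], []), ([1,2,1,2,1,2], []), ([2,3,2,3,2,3,2,3,2,3], []),
     ([0,2], [2,0]), ([1,3], [3,1]), ([0,3], [3,0]), ([1,2,3,1,2,3,1,2,3,1,2,3,1,2,3], [])]"

lemma J1_perm_relators:
  "\<forall>(u, v)\<in>set W_relators. \<forall>p\<in>set points. foldr J1_perm u p = foldr J1_perm v p"
  by (simp add: W_relators_def points_expanded J1_perm_values)

text \<open>The reversal of the diagram, which lets the normal forms for \<open>[5, 3]\<close> describe \<open>\<langle>s\<^sub>3, s\<^sub>2, s\<^sub>1\<rangle>\<close>.\<close>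

definition mirror :: "nat list \<Rightarrow> nat list" where
  "mirror w = map (\<lambda>i. 3 - i) w"

definition H3_longest_word :: "nat list" where
  "H3_longest_word = [0,1,0,1,0,2,1,0,1,0,2,1,0,1,2]"

lemmas H3_words_expanded = H3_words_def[unfolded dihedral_words_def coset_words_def, simplified]

text \<open>The point 61 lies in a regular orbit of \<open>\<langle>s\<^sub>0, s\<^sub>1, s\<^sub>2\<rangle>\<close>, of length 120, and in a regular orbit of
  \<open>\<langle>s\<^sub>1, s\<^sub>2, s\<^sub>3\<rangle>\<close>, of length 60. Hence its image determines an element of either group.\<close>

lemma regular_orbit:
  "\<forall>w\<in>set H3_words. foldr J1_perm w 61 = 61 \<longrightarrow> w = []"
  "\<forall>w\<in>set H3_words. foldr J1_perm (mirror w) 61 = 61 \<longrightarrow> w = [] \<or> w = H3_longest_word"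
  by (simp_all add: H3_words_expanded mirror_def H3_longest_word_def J1_perm_values)

text \<open>Multiplication by the longest element turns length \<open>l\<close> into \<open>15 - l\<close>, so that exactly one of the
  two elements has length at most 7. Such words use only the letters that their image in the
  group of the hemi-icosahedron requires.\<close>

definition short_words :: "nat list list" where
  "short_words = filter (\<lambda>w. length w \<le> 7) H3_words"

lemma short_words_cover:
  "(\<lambda>w. foldr J1_perm (mirror w) 61) ` set H3_words \<subseteq> (\<lambda>w. foldr J1_perm (mirror w) 61) ` set short_words"
  by (simp add: short_words_def H3_words_expanded mirror_def J1_perm_values)

text \<open>The group \<open>\<langle>s\<^sub>1, s\<^sub>2, s\<^sub>3\<rangle>\<close>, which is isomorphic to \<open>A\<^sub>5\<close>, has trivial centre: every normal form
  other than the two trivial ones fails to commute with a generator, and this shows at the point 61.\<close>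

lemma noncentral:
  "\<forall>w\<in>set H3_words. w = [] \<or> w = H3_longest_word \<or>
    (\<exists>i\<in>{1,2,3}. foldr J1_perm (mirror w @ [i]) 61 \<noteq> foldr J1_perm (i # mirror w) 61)"
  by (simp add: H3_words_expanded mirror_def H3_longest_word_def J1_perm_values)

lemma J1_perm_moves: "\<forall>i\<in>{0,1,2,3}. J1_perm i 61 \<noteq> 61"
  by (simp add: J1_perm_values)

text \<open>\<open>block i\<close> is an orbit of the maximal parabolic subgroup \<open>H\<^sub>i\<close>, and \<open>block_base i\<close> a point of it. They
  are chosen such that every listed element of the other maximal parabolic subgroups which is not in
  \<open>H\<^sub>i\<close> moves this point out of the orbit.\<close>

definition block :: "nat \<Rightarrow> nat set" where
  "block i = [{106, 136, 137, 172, 173}, {256, 261, 262, 266}, {36, 42}, {250, 258}] ! i"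

definition block_base :: "nat \<Rightarrow> nat" where
  "block_base i = [106, 256, 36, 250] ! i"

definition maximal_words :: "nat \<Rightarrow> nat list list" where
  "maximal_words j =
    [map mirror short_words,
     map mirror prism_words,
     prism_words,
     H3_words] ! j"

lemma block_invariant:
  "\<forall>i\<in>{0,1,2,3}. \<forall>k\<in>{0,1,2,3} - {i}. \<forall>x\<in>block i. J1_perm k x \<in> block i"
  by (simp add: block_def J1_perm_values insert_Diff_if)

lemma block_moved:
  "\<forall>j\<in>{0,1,2,3}. \<forall>w\<in>set (maximal_words j). \<forall>i\<in>set w. foldr J1_perm w (block_base i) \<notin> block i"
  by (simp add: block_base_def block_def maximal_words_def short_words_def H3_words_expanded prism_words_def dihedral_words_def
      mirror_def J1_perm_values)

section \<open>The representation of the presented group\<close>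

lemma J1_perm_outside: "p \<notin> {1..266} \<Longrightarrow> J1_perm i p = p"
  by (auto simp: J1_perm_def)

lemma foldr_J1_perm_relators:
  assumes "(u, v) \<in> set W_relators"
  shows "foldr J1_perm u = foldr J1_perm v"
proof
  fix p show "foldr J1_perm u p = foldr J1_perm v p"
  proof (cases "p \<in> {1..266}")
    case True
    with J1_perm_relators assms show ?thesis unfolding set_points by blast
  next
    case False
    have "foldr J1_perm w p = p" for w
      by (induction w) (use False J1_perm_outside in auto)
    then show ?thesis by simp
  qed
qed

lemma J1_perm_involution:
  assumes "i < 4"
  shows "J1_perm i (J1_perm i p) = p"
proof -
  have "i = 0 \<or> i = 1 \<or> i = 2 \<or> i = 3" using assms by linarith
  then have "([i, i], []) \<in> set W_relators" by (auto simp: W_relators_def)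
  from foldr_J1_perm_relators[OF this] show ?thesis by (simp add: fun_eq_iff)
qed

lemma J1_perm_permutes:
  assumes "i < 4"
  shows "J1_perm i permutes {1..266}"
  unfolding permutes_def using J1_perm_involution[OF assms] J1_perm_outside by metis

lemma word_prod_sym_group: "word_prod (sym_group n) f w = foldr f w"
  by (induction w) (simp_all add: sym_group_def id_def fun_eq_iff)

lemma gens_replicate: "word_pow (gens w) k = gens (concat (replicate k w))"
  by (induction k) (simp_all add: word_pow_def gens_def)

lemma W_relations_eq: "W_relations = (\<lambda>(u, v). (gens u, gens v)) ` set W_relators"
  by (simp add: W_relations_def W_relators_def gens_replicate numeral_eq_Suc) (simp add: gens_def)

definition H3_relators :: "nat list \<Rightarrow> (nat list \<times> nat list) list" where
  "H3_relators ps = [([0,0], []), ([1,1], []), ([2,2], []),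
     (concat (replicate (ps ! 0) [0,1]), []), (concat (replicate (ps ! 1) [1,2]), []), ([0,2], [2,0])]"

lemma coxeter_relations_rank3:
  "coxeter_relations [p, q] = (\<lambda>(u, v). (gens u, gens v)) ` set (H3_relators [p, q])"
proof -
  have le: "i \<le> length [p, q] \<longleftrightarrow> i = 0 \<or> i = 1 \<or> i = 2" for i by (auto simp: le_Suc_eq)
  have less: "i < length [p, q] \<longleftrightarrow> i = 0 \<or> i = 1" for i by (auto simp: less_Suc_eq)
  have far: "Suc i < j \<and> j \<le> length [p, q] \<longleftrightarrow> i = 0 \<and> j = 2" for i j by auto
  have squares: "{(gens [i, i], []) |i. i = 0 \<or> i = 1 \<or> i = 2} =
      ({(gens [0,0], []), (gens [1,1], []), (gens [2,2], [])} :: (nat word \<times> nat word) set)"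
    by auto
  have powers: "{(word_pow (gens [i, Suc i]) ([p, q] ! i), []) |i. i = 0 \<or> i = 1} =
      ({(gens (concat (replicate p [0,1])), []), (gens (concat (replicate q [1,2])), [])} :: (nat word \<times> nat word) set)"
  proof -
    have "{f i |i. i = 0 \<or> i = 1} = {f 0, f (1::nat)}" for f :: "nat \<Rightarrow> nat word \<times> nat word" by auto
    from this[of "\<lambda>i. (word_pow (gens [i, Suc i]) ([p, q] ! i), [])"] show ?thesis
      by (simp only: gens_replicate nth_Cons_0 nth_Cons_Suc One_nat_def numeral_2_eq_2)
  qed
  have commutation: "{(gens [i, j], gens [j, i]) |i j. i = 0 \<and> j = 2} = {(gens [0,2], gens [2,0])}"
    by auto
  show ?thesis
    unfolding coxeter_relations_def far unfolding le less squares powers commutation H3_relators_def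
    by (simp add: gens_def insert_commute)
qed

lemma presented_hom:
  assumes H: "group H" and f: "f ` S \<subseteq> carrier H"
    and R: "R = (\<lambda>(u, v). (gens u, gens v)) ` set L"
    and L: "\<And>u v. (u, v) \<in> set L \<Longrightarrow> word_prod H f u = word_prod H f v"
  obtains h where "h \<in> hom (presented_group S R) H" "\<And>x. x \<in> S \<Longrightarrow> h (pres_gen S R x) = f x"
proof (rule presented_group_universal[OF H f])
  show "\<exists>xs ys. l = gens xs \<and> r = gens ys \<and> word_prod H f xs = word_prod H f ys"
    if "(l, r) \<in> R" for l r
  proof -
    from that obtain u v where "(u, v) \<in> set L" "l = gens u" "r = gens v" unfolding R by auto
    with L show ?thesis by blast
  qed
qed (rule that)

interpretation W: group W_group
  unfolding W_group_def by (rule presented_group_is_group)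

lemma W_gen_carrier: "i < 4 \<Longrightarrow> W_gen i \<in> carrier W_group"
  unfolding W_group_def W_gen_def by (rule pres_gen_closed) auto

lemma W_gen_image: "I \<subseteq> {..<4} \<Longrightarrow> W_gen ` I \<subseteq> carrier W_group"
  using W_gen_carrier by auto

lemma W_generate: "generate W_group (W_gen ` {..<4}) = carrier W_group"
proof -
  have "{..<4::nat} = {0, 1, 2, 3}" by auto
  then show ?thesis unfolding W_group_def W_gen_def by (simp only: generate_pres_gen)
qed

lemma W_relator:
  assumes "(u, v) \<in> set W_relators"
  shows "word_prod W_group W_gen u = word_prod W_group W_gen v"
proof -
  have "(gens u, gens v) \<in> W_relations" using assms by (auto simp: W_relations_eq)
  moreover have "set u \<subseteq> {0,1,2,3}" "set v \<subseteq> {0,1,2,3}" using assms by (auto simp: W_relators_def)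
  ultimately show ?thesis unfolding W_group_def W_gen_def by (rule pres_gen_relation)
qed

lemma W_square:
  assumes "i < 4"
  shows "W_gen i \<otimes>\<^bsub>W_group\<^esub> W_gen i = \<one>\<^bsub>W_group\<^esub>"
proof -
  have "i = 0 \<or> i = 1 \<or> i = 2 \<or> i = 3" using assms by linarith
  then have "([i, i], []) \<in> set W_relators" by (auto simp: W_relators_def)
  from W_relator[OF this] assms W_gen_carrier show ?thesis by simp
qed

lemma W_commute:
  assumes "(i, j) \<in> {(0, 2), (1, 3), (0, 3), (2, 0), (3, 1), (3, 0)}"
  shows "W_gen i \<otimes>\<^bsub>W_group\<^esub> W_gen j = W_gen j \<otimes>\<^bsub>W_group\<^esub> W_gen i"
proof -
  have "([i, j], [j, i]) \<in> set W_relators \<or> ([j, i], [i, j]) \<in> set W_relators"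
    using assms by (auto simp: W_relators_def)
  moreover have "i < 4" "j < 4" using assms by auto
  ultimately show ?thesis using W_relator[of "[i, j]" "[j, i]"] W_relator[of "[j, i]" "[i, j]"] W_gen_carrier by auto
qed

lemma (in group) word_prod_rev:
  assumes "s ` set w \<subseteq> carrier G" "\<And>i. i \<in> set w \<Longrightarrow> s i \<otimes> s i = \<one>" "word_prod G s w = \<one>"
  shows "word_prod G s (rev w) = \<one>"
proof -
  have "word_prod G s (rev w) \<otimes> word_prod G s w = \<one>"
    using assms(1,2)
  proof (induction w)
    case (Cons i w)
    then have c: "s i \<in> carrier G" "word_prod G s w \<in> carrier G" "word_prod G s (rev w) \<in> carrier G"
      by (simp_all add: word_prod_closed)
    have "word_prod G s (rev (i # w)) = word_prod G s (rev w) \<otimes> s i"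
      using Cons.prems c by (simp add: word_prod_append)
    then have "word_prod G s (rev (i # w)) \<otimes> word_prod G s (i # w)
        = word_prod G s (rev w) \<otimes> (s i \<otimes> s i) \<otimes> word_prod G s w"
      using c by (simp add: m_assoc)
    with Cons c show ?case by simp
  qed simp
  moreover have "word_prod G s (rev w) \<in> carrier G" using assms(1) by (simp add: word_prod_closed)
  ultimately show ?thesis using assms(3) by simp
qed

lemma W_relator_rev:
  assumes "(u, []) \<in> set W_relators"
  shows "word_prod W_group W_gen (rev u) = \<one>\<^bsub>W_group\<^esub>"
proof (rule W.word_prod_rev)
  have "set u \<subseteq> {..<4}" using assms by (auto simp: W_relators_def)
  then show "W_gen ` set u \<subseteq> carrier W_group" "\<And>i. i \<in> set u \<Longrightarrow> W_gen i \<otimes>\<^bsub>W_group\<^esub> W_gen i = \<one>\<^bsub>W_group\<^esub>"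
    using W_gen_image W_square by auto
  show "word_prod W_group W_gen u = \<one>\<^bsub>W_group\<^esub>" using W_relator[OF assms] by simp
qed

interpretation facet: H3_relations W_group W_gen
proof unfold_locales
  have "([0,1,0,1,0,1,0,1,0,1], []) \<in> set W_relators" "([1,2,1,2,1,2], []) \<in> set W_relators"
    by (simp_all add: W_relators_def)
  from this[THEN W_relator] show "word_prod W_group W_gen [0,1,0,1,0,1,0,1,0,1] = \<one>\<^bsub>W_group\<^esub>"
    "word_prod W_group W_gen [1,2,1,2,1,2] = \<one>\<^bsub>W_group\<^esub>" by (simp_all only: word_prod_Nil)
qed (simp_all add: W_gen_carrier W_square W_commute)

interpretation vertex: H3_relations W_group "\<lambda>i. W_gen (3 - i)"
proof unfold_locales
  have "([2,3,2,3,2,3,2,3,2,3], []) \<in> set W_relators" "([1,2,1,2,1,2], []) \<in> set W_relators"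
    by (simp_all add: W_relators_def)
  from this[THEN W_relator_rev]
  show "word_prod W_group (\<lambda>i. W_gen (3 - i)) [0,1,0,1,0,1,0,1,0,1] = \<one>\<^bsub>W_group\<^esub>"
    "word_prod W_group (\<lambda>i. W_gen (3 - i)) [1,2,1,2,1,2] = \<one>\<^bsub>W_group\<^esub>"
    by simp_all
qed (simp_all add: W_gen_carrier W_square W_commute)

lemma word_prod_mirror:
  "word_prod G (\<lambda>i. s (3 - i)) w = word_prod G s (mirror w)"
  by (simp add: mirror_def word_prod_map)

lemma H3_longest_trivial: "word_prod W_group (\<lambda>i. W_gen (3 - i)) H3_longest_word = \<one>\<^bsub>W_group\<^esub>"
proof -
  have "([1,2,3,1,2,3,1,2,3,1,2,3,1,2,3], []) \<in> set W_relators" by (simp add: W_relators_def)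
  from W_relator_rev[OF this]
  have "word_prod W_group (\<lambda>i. W_gen (3 - i)) [0,1,2,0,1,2,0,1,2,0,1,2,0,1,2] = \<one>\<^bsub>W_group\<^esub>" by simp
  then show ?thesis unfolding vertex.H3_longest H3_longest_word_def .
qed

lemma sym_group_hom_ex:
  "\<exists>\<theta>. \<theta> \<in> hom W_group (sym_group 266) \<and> (\<forall>i<4. \<theta> (W_gen i) = J1_perm i)"
proof -
  have "J1_perm ` {0,1,2,3} \<subseteq> carrier (sym_group 266)"
    using J1_perm_permutes by (auto simp: sym_group_carrier)
  then obtain \<theta> where \<theta>: "\<theta> \<in> hom W_group (sym_group 266)" "\<And>i. i \<in> {0,1,2,3} \<Longrightarrow> \<theta> (W_gen i) = J1_perm i"
    unfolding W_group_def W_gen_def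
    by (rule presented_hom[OF sym_group_is_group _ W_relations_eq, of _ "{0,1,2,3}"])
      (simp_all add: word_prod_sym_group foldr_J1_perm_relators)
  have "i \<in> {0,1,2,3}" if "i < 4" for i :: nat using that by auto
  with \<theta> show ?thesis by blast
qed

definition J1_rep :: "nat word set \<Rightarrow> nat \<Rightarrow> nat" where
  "J1_rep = (SOME \<theta>. \<theta> \<in> hom W_group (sym_group 266) \<and> (\<forall>i<4. \<theta> (W_gen i) = J1_perm i))"

lemma J1_rep: "J1_rep \<in> hom W_group (sym_group 266)" "i < 4 \<Longrightarrow> J1_rep (W_gen i) = J1_perm i"
  using someI_ex[OF sym_group_hom_ex] unfolding J1_rep_def by blast+

interpretation rep: group_hom W_group "sym_group 266" J1_rep
  by (intro group_hom.intro group_hom_axioms.intro sym_group_is_group J1_rep W.group_axioms)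

lemma J1_rep_word:
  assumes "set w \<subseteq> {..<4}"
  shows "J1_rep (word_prod W_group W_gen w) = foldr J1_perm w"
proof -
  have "J1_rep (word_prod W_group W_gen w) = word_prod (sym_group 266) (\<lambda>i. J1_rep (W_gen i)) w"
    by (rule rep.hom_word_prod) (rule W_gen_image[OF assms])
  also have "\<dots> = word_prod (sym_group 266) J1_perm w"
    by (rule word_prod_cong) (use assms J1_rep(2) in auto)
  finally show ?thesis by (simp add: word_prod_sym_group)
qed

lemma J1_rep_mult:
  "x \<in> carrier W_group \<Longrightarrow> y \<in> carrier W_group \<Longrightarrow> J1_rep (x \<otimes>\<^bsub>W_group\<^esub> y) p = J1_rep x (J1_rep y p)"
  using rep.hom_mult[of x y] by (simp add: sym_group_mult)

lemma J1_rep_one: "J1_rep \<one>\<^bsub>W_group\<^esub> p = p"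
  using rep.hom_one by (simp add: sym_group_one)

lemma mirror_letters: "set w \<subseteq> {..<3} \<Longrightarrow> set (mirror w) \<subseteq> {..<4} - {0}"
  by (auto simp: mirror_def)

lemma vertex_group_eq: "W_gen ` ({..<4} - {0}) = (\<lambda>i. W_gen (3 - i)) ` {..<3}"
proof -
  have "{..<3} = {0, 1, 2::nat}" "{..<4} - {0} = {1, 2, 3::nat}" by auto
  then have "{..<4} - {0} = (\<lambda>i::nat. 3 - i) ` {..<3}" by auto
  then show ?thesis by (simp add: image_image)
qed

text \<open>The covering group \<open>[3, 5]\<close> has two normal forms fixing the point 61, but the nontrivial one is
  trivial in \<open>W\<close> by the relation \<open>(s\<^sub>1 s\<^sub>2 s\<^sub>3)\<^sup>5 = 1\<close>.\<close>

lemma vertex_fixing_trivial: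
  assumes "x \<in> generate W_group (W_gen ` ({..<4} - {0}))" "J1_rep x 61 = 61"
  shows "x = \<one>\<^bsub>W_group\<^esub>"
proof -
  obtain w where w: "w \<in> set H3_words" "x = word_prod W_group (\<lambda>i. W_gen (3 - i)) w"
    using assms(1) vertex.H3_cover unfolding vertex_group_eq by blast
  have "set (mirror w) \<subseteq> {..<4}" using mirror_letters[OF H3_letters[OF w(1)]] by auto
  then have "w = [] \<or> w = H3_longest_word"
    using assms(2) w regular_orbit(2) by (auto simp: J1_rep_word word_prod_mirror)
  then show ?thesis using H3_longest_trivial w(2) by (elim disjE) simp_all
qed

section \<open>The intersection property\<close>

lemma maximal_words_letters:
  assumes "j < 4" "w \<in> set (maximal_words j)"
  shows "set w \<subseteq> {..<4} - {j}"
proof -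
  have "j = 0 \<or> j = 1 \<or> j = 2 \<or> j = 3" using assms(1) by linarith
  then show ?thesis
  proof (elim disjE)
    assume "j = 0"
    then show ?thesis using assms(2) mirror_letters[OF H3_letters]
      by (auto simp: maximal_words_def short_words_def)
  next
    assume "j = 3"
    then show ?thesis using assms(2) H3_letters by (fastforce simp: maximal_words_def)
  next
    assume j: "j = 1"
    then obtain v where "w = mirror v" "v \<in> set prism_words" using assms(2) by (auto simp: maximal_words_def)
    moreover from this have "set v \<subseteq> {0,1,3}"
      using dihedral_letters by (fastforce simp: prism_words_def less_2_cases_iff)
    ultimately show ?thesis using j by (auto simp: mirror_def)
  next
    assume j: "j = 2"
    then have "w \<in> set prism_words" using assms(2) by (simp add: maximal_words_def)
    then have "set w \<subseteq> {0,1,3}"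
      using dihedral_letters by (fastforce simp: prism_words_def less_2_cases_iff)
    then show ?thesis using j by auto
  qed
qed

lemma maximal_words_cover:
  assumes "j < 4"
  shows "generate W_group (W_gen ` ({..<4} - {j})) \<subseteq> word_prod W_group W_gen ` set (maximal_words j)"
proof -
  have "j = 0 \<or> j = 1 \<or> j = 2 \<or> j = 3" using assms(1) by linarith
  then show ?thesis
  proof (elim disjE)
    assume j: "j = 3"
    have "{..<4} - {3::nat} = {..<3}" by auto
    with j facet.H3_cover show ?thesis by (simp add: maximal_words_def)
  next
    assume j: "j = 2"
    have "{..<4} - {2::nat} = {3} \<union> {..<2}" by auto
    moreover have "generate W_group (W_gen ` ({3} \<union> {..<2})) \<subseteq> word_prod W_group W_gen ` set prism_words"
      by (rule facet.prism_cover) (simp_all add: W_gen_carrier W_square W_commute)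
    ultimately show ?thesis using j by (simp add: maximal_words_def)
  next
    assume j: "j = 1"
    have "{..<4} - {1::nat} = (\<lambda>i. 3 - i) ` ({3} \<union> {..<2})" 
    proof -
      have "{..<2} = {0, 1::nat}" "{..<4} - {1} = {0, 2, 3::nat}" by auto
      then show ?thesis by auto
    qed
    then have "W_gen ` ({..<4} - {1}) = (\<lambda>i. W_gen (3 - i)) ` ({3} \<union> {..<2})" by (simp only: image_image)
    moreover have "generate W_group ((\<lambda>i. W_gen (3 - i)) ` ({3} \<union> {..<2}))
        \<subseteq> word_prod W_group (\<lambda>i. W_gen (3 - i)) ` set prism_words"
      by (rule vertex.prism_cover) (simp_all add: W_gen_carrier W_square W_commute)
    moreover have "word_prod W_group (\<lambda>i. W_gen (3 - i)) ` set prism_words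
        = word_prod W_group W_gen ` set (maximal_words 1)"
      by (simp add: maximal_words_def image_image word_prod_mirror[of W_group W_gen])
    ultimately show ?thesis using j by (simp only:)
  next
    assume j: "j = 0"
    show ?thesis
    proof
      fix x assume "x \<in> generate W_group (W_gen ` ({..<4} - {j}))"
      then have x: "x \<in> generate W_group (W_gen ` ({..<4} - {0}))" by (simp add: j)
      then obtain w where w: "w \<in> set H3_words" "x = word_prod W_group W_gen (mirror w)"
        using vertex.H3_cover unfolding vertex_group_eq word_prod_mirror by blast
      obtain w' where w': "w' \<in> set short_words"
        "foldr J1_perm (mirror w) 61 = foldr J1_perm (mirror w') 61"
        using w(1) short_words_cover by blast
      have H: "w' \<in> set H3_words" using w'(1) by (simp add: short_words_def)
      \<comment> \<open>\<open>w\<close> and \<open>w'\<close> agree on the point 61, hence represent the same element of \<open>W\<close>.\<close>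
      define y where "y = word_prod W_group W_gen (mirror w')"
      have l: "set (mirror w) \<subseteq> {..<4} - {0}" "set (mirror w') \<subseteq> {..<4} - {0}"
        using mirror_letters H3_letters w(1) H by auto
      have y: "y \<in> generate W_group (W_gen ` ({..<4} - {0}))"
        unfolding y_def by (rule W.word_prod_in_generate[OF l(2)]) (rule W_gen_image, auto)
      have sub: "subgroup (generate W_group (W_gen ` ({..<4} - {0}))) W_group"
        by (rule W.generate_is_subgroup) (rule W_gen_image, auto)
      have c: "x \<in> carrier W_group" "y \<in> carrier W_group" using x y subgroup.subset[OF sub] by auto
      have "J1_rep x 61 = J1_rep y 61"
        using l w'(2) by (simp add: w(2) y_def J1_rep_word subset_Diff_insert)
      then have "J1_rep (inv\<^bsub>W_group\<^esub> y \<otimes>\<^bsub>W_group\<^esub> x) 61 = J1_rep (inv\<^bsub>W_group\<^esub> y \<otimes>\<^bsub>W_group\<^esub> y) 61"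
        using c by (simp only: J1_rep_mult W.inv_closed)
      then have "J1_rep (inv\<^bsub>W_group\<^esub> y \<otimes>\<^bsub>W_group\<^esub> x) 61 = 61" using c by (simp add: sym_group_one)
      moreover have "inv\<^bsub>W_group\<^esub> y \<otimes>\<^bsub>W_group\<^esub> x \<in> generate W_group (W_gen ` ({..<4} - {0}))"
        using sub x y by (simp add: subgroup.m_closed subgroup.m_inv_closed)
      ultimately have "inv\<^bsub>W_group\<^esub> y \<otimes>\<^bsub>W_group\<^esub> x = \<one>\<^bsub>W_group\<^esub>" by (rule vertex_fixing_trivial[rotated])
      then have "x = y" using c by (simp add: W.inv_solve_left')
      then show "x \<in> word_prod W_group W_gen ` set (maximal_words j)"
        using w'(1) by (simp add: y_def j maximal_words_def)
    qed
  qed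
qed

lemma parabolic_preserves_block:
  assumes i: "i < 4" and x: "x \<in> generate W_group (W_gen ` ({..<4} - {i}))"
  shows "J1_rep x ` block i \<subseteq> block i"
proof -
  have "generate W_group (W_gen ` ({..<4} - {i})) \<subseteq> {x \<in> carrier W_group. J1_rep x ` block i \<subseteq> block i}"
  proof (rule W.generate_subset_right_closed)
    fix x k assume x: "x \<in> {x \<in> carrier W_group. J1_rep x ` block i \<subseteq> block i}" and k: "k \<in> {..<4} - {i}"
    have "i \<in> {0,1,2,3}" "k \<in> {0,1,2,3} - {i}" using i k by auto
    then have "\<forall>p\<in>block i. J1_rep (W_gen k) p \<in> block i"
      using block_invariant k J1_rep(2)[of k] by auto
    then show "x \<otimes>\<^bsub>W_group\<^esub> W_gen k \<in> {x \<in> carrier W_group. J1_rep x ` block i \<subseteq> block i}"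
      using x k W_gen_carrier[of k] by (auto simp: sym_group_mult)
  qed (auto simp: W_gen_carrier W_square sym_group_one)
  with x show ?thesis by blast
qed

lemma maximal_words_separated:
  assumes j: "j < 4" and w: "w \<in> set (maximal_words j)" and i: "i \<in> set w"
  shows "word_prod W_group W_gen w \<notin> generate W_group (W_gen ` ({..<4} - {i}))"
proof
  assume "word_prod W_group W_gen w \<in> generate W_group (W_gen ` ({..<4} - {i}))"
  moreover have i4: "i < 4" "set w \<subseteq> {..<4}" using maximal_words_letters[OF j w] i by auto
  moreover have "block_base i \<in> block i"
  proof -
    have "i = 0 \<or> i = 1 \<or> i = 2 \<or> i = 3" using i4 by linarith
    then show ?thesis by (auto simp: block_base_def block_def)
  qed
  ultimately have "foldr J1_perm w (block_base i) \<in> block i"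
    using parabolic_preserves_block[of i "word_prod W_group W_gen w"] by (auto simp: J1_rep_word)
  moreover have "j \<in> {0,1,2,3}" using j by auto
  ultimately show False using block_moved w i by blast
qed

lemma W_string_C_group: "string_C_group W_group 4 W_gen"
  unfolding string_C_group_def
proof (intro conjI allI impI)
  show "group W_group" by (rule W.group_axioms)
  show "W_gen i \<in> carrier W_group" "W_gen i \<otimes>\<^bsub>W_group\<^esub> W_gen i = \<one>\<^bsub>W_group\<^esub>" if "i < 4" for i
    using that W_gen_carrier W_square by auto
  show "W_gen i \<noteq> \<one>\<^bsub>W_group\<^esub>" if "i < 4" for i
  proof -
    have "i \<in> {0,1,2,3}" using that by auto
    with J1_perm_moves J1_rep(2)[OF that] J1_rep_one show ?thesis by metis
  qed
  show "generate W_group (W_gen ` {..<4}) = carrier W_group" by (rule W_generate)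
  show "W_gen i \<otimes>\<^bsub>W_group\<^esub> W_gen j = W_gen j \<otimes>\<^bsub>W_group\<^esub> W_gen i"
    if "i < 4" "j < 4" "j \<noteq> i \<and> j \<noteq> i + 1 \<and> i \<noteq> j + 1" for i j
  proof (rule W_commute)
    have "i = 0 \<or> i = 1 \<or> i = 2 \<or> i = 3" "j = 0 \<or> j = 1 \<or> j = 2 \<or> j = 3"
      using that(1,2) by linarith+
    with that(3) show "(i, j) \<in> {(0, 2), (1, 3), (0, 3), (2, 0), (3, 1), (3, 0)}"
      by (elim disjE) simp_all
  qed
  show "generate W_group (W_gen ` I) \<inter> generate W_group (W_gen ` J) = generate W_group (W_gen ` (I \<inter> J))"
    if "I \<subseteq> {..<4} \<and> J \<subseteq> {..<4}" for I J
    by (rule intersection_property_from_words[OF W.group_axioms W_gen_image, of 4 "\<lambda>j. set (maximal_words j)"])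
      (use that maximal_words_letters maximal_words_cover maximal_words_separated in blast)+
qed

section \<open>Facets and vertex figures of the polytope\<close>

text \<open>Constants of their own keep the simplifier from rewriting the index set \<open>{..length [p, q]}\<close> in the
  middle of a group.\<close>

definition rank3_group :: "nat \<Rightarrow> nat \<Rightarrow> nat word set monoid" where
  "rank3_group p q = coxeter_group [p, q]"

definition rank3_gen :: "nat \<Rightarrow> nat \<Rightarrow> nat \<Rightarrow> nat word set" where
  "rank3_gen p q = coxeter_gen [p, q]"

abbreviation "C53 \<equiv> rank3_group 5 3"
abbreviation "C35 \<equiv> rank3_group 3 5"

lemma rank3_generators:
  "rank3_gen p q ` {..<3} \<subseteq> carrier (rank3_group p q)"
  "generate (rank3_group p q) (rank3_gen p q ` {..<3}) = carrier (rank3_group p q)"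
proof -
  have eq: "{..<3} = {..length [p, q]}" by auto
  show "rank3_gen p q ` {..<3} \<subseteq> carrier (rank3_group p q)"
    unfolding eq rank3_group_def rank3_gen_def by (intro image_subsetI pres_gen_closed)
  show "generate (rank3_group p q) (rank3_gen p q ` {..<3}) = carrier (rank3_group p q)"
    unfolding eq rank3_group_def rank3_gen_def by (rule generate_pres_gen)
qed

lemma rank3_group: "group (rank3_group p q)"
  unfolding rank3_group_def by (rule presented_group_is_group)

lemma H3_relators_letters:
  assumes "(u, v) \<in> set (H3_relators [p, q])"
  shows "set u \<subseteq> {..2}" "set v \<subseteq> {..2}"
proof -
  have "set (concat (replicate k w)) \<subseteq> set w" for k and w :: "nat list"
    by (induction k) auto
  from this[of p "[0, 1]"] this[of q "[1, 2]"] assms show "set u \<subseteq> {..2}" "set v \<subseteq> {..2}"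
    unfolding H3_relators_def by auto
qed

lemma rank3_relator:
  assumes "(u, v) \<in> set (H3_relators [p, q])"
  shows "word_prod (rank3_group p q) (rank3_gen p q) u = word_prod (rank3_group p q) (rank3_gen p q) v"
  unfolding rank3_group_def rank3_gen_def
proof (rule pres_gen_relation)
  show "(gens u, gens v) \<in> coxeter_relations [p, q]"
    unfolding coxeter_relations_rank3 using assms by (force simp del: set_concat)
  have "length [p, q] = 2" by simp
  then show "set u \<subseteq> {..length [p, q]}" "set v \<subseteq> {..length [p, q]}"
    using H3_relators_letters[OF assms] by (simp_all only:)
qed

lemma rank3_hom:
  assumes H: "group H" and f: "f ` {..<3} \<subseteq> carrier H"
    and L: "\<And>u v. (u, v) \<in> set (H3_relators [p, q]) \<Longrightarrow> word_prod H f u = word_prod H f v"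
  shows "\<exists>h. h \<in> hom (rank3_group p q) H \<and> (\<forall>i<3. h (rank3_gen p q i) = f i)"
proof -
  have eq: "{..<3} = {..length [p, q]}" by auto
  obtain h where "h \<in> hom (rank3_group p q) H" "\<And>i. i \<in> {..length [p, q]} \<Longrightarrow> h (rank3_gen p q i) = f i"
    unfolding rank3_group_def rank3_gen_def
    using presented_hom[OF H f[unfolded eq] coxeter_relations_rank3 L] by blast
  then show ?thesis by (simp only: eq[symmetric]) auto
qed

lemma H3_relators_53:
  "H3_relators [5, 3] = [([0,0], []), ([1,1], []), ([2,2], []),
     ([0,1,0,1,0,1,0,1,0,1], []), ([1,2,1,2,1,2], []), ([0,2], [2,0])]"
  and H3_relators_35:
  "H3_relators [3, 5] = [([0,0], []), ([1,1], []), ([2,2], []),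
     ([0,1,0,1,0,1], []), ([1,2,1,2,1,2,1,2,1,2], []), ([0,2], [2,0])]"
  by (simp_all add: H3_relators_def numeral_eq_Suc)

lemma H3_relations_35: "H3_relations C35 (\<lambda>i. rank3_gen 3 5 (2 - i))"
proof -
  interpret C: group C35 by (rule rank3_group)
  have c: "i < 3 \<Longrightarrow> rank3_gen 3 5 i \<in> carrier C35" for i using rank3_generators(1) by blast
  have rel: "([0,0], []) \<in> set (H3_relators [3, 5])" "([1,1], []) \<in> set (H3_relators [3, 5])"
    "([2,2], []) \<in> set (H3_relators [3, 5])" "([0,1,0,1,0,1], []) \<in> set (H3_relators [3, 5])"
    "([1,2,1,2,1,2,1,2,1,2], []) \<in> set (H3_relators [3, 5])" "([0,2], [2,0]) \<in> set (H3_relators [3, 5])"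
    by (simp_all add: H3_relators_35 H3_relators_53)
  note r = rel[THEN rank3_relator]
  have sq: "rank3_gen 3 5 i \<otimes>\<^bsub>C35\<^esub> rank3_gen 3 5 i = \<one>\<^bsub>C35\<^esub>" if "i < 3" for i
  proof -
    have "i = 0 \<or> i = 1 \<or> i = 2" using that by linarith
    then show ?thesis using r(1-3) c by auto
  qed
  have rev: "word_prod C35 (rank3_gen 3 5) (rev u) = \<one>\<^bsub>C35\<^esub>"
    if "set u \<subseteq> {..<3}" "word_prod C35 (rank3_gen 3 5) u = \<one>\<^bsub>C35\<^esub>" for u
    by (rule C.word_prod_rev) (use that c sq in auto)
  have "word_prod C35 (rank3_gen 3 5) [1,0,1,0,1,0] = \<one>\<^bsub>C35\<^esub>"
    "word_prod C35 (rank3_gen 3 5) [2,1,2,1,2,1,2,1,2,1] = \<one>\<^bsub>C35\<^esub>"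
    using rev[of "[0,1,0,1,0,1]"] rev[of "[1,2,1,2,1,2,1,2,1,2]"] r(4,5) by simp_all
  moreover have "rank3_gen 3 5 0 \<otimes>\<^bsub>C35\<^esub> rank3_gen 3 5 2 = rank3_gen 3 5 2 \<otimes>\<^bsub>C35\<^esub> rank3_gen 3 5 0"
    using r(6) c by simp
  ultimately show ?thesis
    by unfold_locales (simp_all add: c sq)
qed

lemma H3_relations_53: "H3_relations C53 (rank3_gen 5 3)"
proof -
  interpret C: group C53 by (rule rank3_group)
  have c: "i < 3 \<Longrightarrow> rank3_gen 5 3 i \<in> carrier C53" for i using rank3_generators(1) by blast
  have rel: "([0,0], []) \<in> set (H3_relators [5, 3])" "([1,1], []) \<in> set (H3_relators [5, 3])"
    "([2,2], []) \<in> set (H3_relators [5, 3])" "([0,1,0,1,0,1,0,1,0,1], []) \<in> set (H3_relators [5, 3])"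
    "([1,2,1,2,1,2], []) \<in> set (H3_relators [5, 3])" "([0,2], [2,0]) \<in> set (H3_relators [5, 3])"
    by (simp_all add: H3_relators_35 H3_relators_53)
  note r = rel[THEN rank3_relator]
  show ?thesis
    by unfold_locales (use r c in simp_all)
qed

lemma facet_isomorphic:
  assumes F: "F \<in> proper_faces W_group 4 W_gen 3"
  shows "poset_isomorphic (section_below (polytope W_group 4 W_gen) F) dodecahedron"
proof -
  interpret C: H3_relations C53 "rank3_gen 5 3" by (rule H3_relations_53)
  have W3: "W_gen ` {..<3} \<subseteq> carrier W_group" by (rule W_gen_image) auto
  have "word_prod W_group W_gen u = word_prod W_group W_gen v" if "(u, v) \<in> set (H3_relators [5, 3])" for u v
    by (rule W_relator) (use that in \<open>auto simp: H3_relators_53 W_relators_def\<close>)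
  from rank3_hom[OF W.group_axioms W3 this]
  obtain h where h: "h \<in> hom C53 W_group" "\<And>i. i < 3 \<Longrightarrow> h (rank3_gen 5 3 i) = W_gen i" by blast
  interpret h: group_hom C53 W_group h by unfold_locales (rule h)
  obtain w where w: "w \<in> carrier W_group" "F = Coset_Face 3 (maximal_parabolic W_group 4 W_gen 3 #>\<^bsub>W_group\<^esub> w)"
    using F by (auto simp: proper_faces_def RCOSETS_def maximal_parabolic_def)
  interpret S: polytope_section W_group C53 W_gen "rank3_gen 5 3" 3 0 3 h w
    by (rule polytope_section.intro) (use W_string_C_group rank3_group rank3_generators h w in simp_all)
  have "kernel C53 W_group h = {\<one>\<^bsub>C53\<^esub>}"
  proof
    show "kernel C53 W_group h \<subseteq> {\<one>\<^bsub>C53\<^esub>}"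
    proof
      fix x assume x: "x \<in> kernel C53 W_group h"
      then have "x \<in> carrier C53" by (simp add: kernel_def)
      then obtain v where v: "v \<in> set H3_words" "x = word_prod C53 (rank3_gen 5 3) v"
        using C.H3_cover rank3_generators(2)[of 5 3] by auto
      have l: "set v \<subseteq> {..<3}" by (rule H3_letters[OF v(1)])
      then have "h x = word_prod W_group (\<lambda>i. h (rank3_gen 5 3 i)) v"
        unfolding v(2) by (intro h.hom_word_prod C.letters_carrier)
      also have "\<dots> = word_prod W_group W_gen v"
        by (rule word_prod_cong) (use l h(2) in auto)
      finally have "word_prod W_group W_gen v = \<one>\<^bsub>W_group\<^esub>" using x by (simp add: kernel_def)
      then have "foldr J1_perm v 61 = 61"
        using J1_rep_word[of v] l J1_rep_one[of 61] by fastforce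
      then have "v = []" using regular_orbit(1) v(1) by blast
      then show "x \<in> {\<one>\<^bsub>C53\<^esub>}" by (simp add: v(2))
    qed
  qed (use S.one_ker in simp)
  from S.section_isomorphic[OF this] show ?thesis
    unfolding dodecahedron_def rank3_group_def[symmetric] rank3_gen_def[symmetric]
    by (simp add: S.section_def w(2))
qed

text \<open>At most the normal forms 1 and \<open>z\<close>, the longest element, are in the kernel, since the point 61 is
  fixed by no other. A normal subgroup of order 2 is central. Conversely a central element maps to the
  centre of the image, which is trivial, so it is in the kernel.\<close>

lemma icosahedral_kernel:
  assumes h: "h \<in> hom C35 W_group" "\<And>i. i < 3 \<Longrightarrow> h (rank3_gen 3 5 i) = W_gen (i + 1)"
  shows "kernel C35 W_group h = {\<one>\<^bsub>C35\<^esub>, central_element C35}"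
    (is "?ker = _")
proof -
  let ?t = "\<lambda>i. rank3_gen 3 5 (2 - i)"
  interpret C: H3_relations C35 ?t by (rule H3_relations_35)
  interpret h: group_hom C35 W_group h by unfold_locales (rule h)
  have cover: "\<exists>w\<in>set H3_words. x = word_prod C35 ?t w" if "x \<in> carrier C35" for x
  proof -
    have "{..<3} = {0, 1, 2::nat}" by auto
    then have "(\<lambda>i::nat. 2 - i) ` {..<3} = {..<3}" by auto
    then have "?t ` {..<3} = rank3_gen 3 5 ` {..<3}" by (metis image_image)
    with that C.H3_cover rank3_generators(2)[of 3 5] show ?thesis by auto
  qed
  have h_word: "h (word_prod C35 ?t w) = word_prod W_group W_gen (mirror w)" if "w \<in> set H3_words" for w
  proof -
    have l: "set w \<subseteq> {..<3}" by (rule H3_letters[OF that])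
    then have "h (word_prod C35 ?t w) = word_prod W_group (\<lambda>i. h (?t i)) w"
      by (intro h.hom_word_prod C.letters_carrier)
    also have "\<dots> = word_prod W_group (\<lambda>i. W_gen (3 - i)) w"
    proof (rule word_prod_cong)
      fix i assume "i \<in> set w"
      with l have "i < 3" by auto
      then have "2 - i + 1 = 3 - i" "2 - i < 3" by auto
      with h(2)[of "2 - i"] show "h (?t i) = W_gen (3 - i)" by simp
    qed
    finally show ?thesis by (simp add: word_prod_mirror)
  qed
  have rep_h: "J1_rep (h (word_prod C35 ?t w)) = foldr J1_perm (mirror w)" if "w \<in> set H3_words" for w
    using mirror_letters[OF H3_letters[OF that]] by (subst h_word[OF that], intro J1_rep_word) auto
  define z where "z = word_prod C35 ?t H3_longest_word"
  have longest: "H3_longest_word \<in> set H3_words"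
    by (simp add: H3_words_expanded H3_longest_word_def)
  have zc: "z \<in> carrier C35"
    unfolding z_def by (intro C.word_prod_closed C.letters_carrier H3_letters longest)
  have hz: "h z = \<one>\<^bsub>W_group\<^esub>"
    unfolding z_def h_word[OF longest] using H3_longest_trivial by (simp add: word_prod_mirror)
  have z1: "z \<noteq> \<one>\<^bsub>C35\<^esub>"
  proof -
    \<comment> \<open>The reversed diagram also maps onto \<open>\<langle>s\<^sub>0, s\<^sub>1, s\<^sub>2\<rangle>\<close>, where the longest element survives.\<close>
    have f: "(\<lambda>i. W_gen (2 - i)) ` {..<3} \<subseteq> carrier W_group" using W_gen_carrier by auto
    have "word_prod W_group (\<lambda>i. W_gen (2 - i)) u = word_prod W_group (\<lambda>i. W_gen (2 - i)) v"
      if uv: "(u, v) \<in> set (H3_relators [3, 5])" for u v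
    proof -
      have "word_prod W_group W_gen (map (\<lambda>i. 2 - i) u) = word_prod W_group W_gen (map (\<lambda>i. 2 - i) v)"
      proof (cases "v = []")
        case True
        have "(rev (map (\<lambda>i. 2 - i) u), []) \<in> set W_relators"
          using uv True by (auto simp: H3_relators_35 W_relators_def)
        from W_relator_rev[OF this] True show ?thesis by simp
      next
        case False
        then have "u = [0,2]" "v = [2,0]" using uv by (auto simp: H3_relators_35)
        then show ?thesis using W_commute[of 2 0] W_gen_carrier by simp
      qed
      then show ?thesis by (simp only: word_prod_map)
    qed
    from rank3_hom[OF W.group_axioms f this] obtain k
      where k: "k \<in> hom C35 W_group" "\<And>i. i < 3 \<Longrightarrow> k (rank3_gen 3 5 i) = W_gen (2 - i)" by blast
    interpret k: group_hom C35 W_group k by unfold_locales (rule k)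
    have l: "set H3_longest_word \<subseteq> {..<3}" by (rule H3_letters[OF longest])
    have "k z = word_prod W_group (\<lambda>i. k (?t i)) H3_longest_word"
      unfolding z_def using l by (intro k.hom_word_prod C.letters_carrier)
    also have "\<dots> = word_prod W_group W_gen H3_longest_word"
      by (rule word_prod_cong) (use l k(2) in \<open>auto\<close>)
    finally have "J1_rep (k z) 61 = foldr J1_perm H3_longest_word 61"
      using l by (subst J1_rep_word[symmetric]) auto
    then have "J1_rep (k z) 61 \<noteq> 61"
      using regular_orbit(1) longest by (auto simp: H3_longest_word_def)
    then show ?thesis using J1_rep_one by auto
  qed
  have ker: "?ker = {\<one>\<^bsub>C35\<^esub>, z}"
  proof
    show "?ker \<subseteq> {\<one>\<^bsub>C35\<^esub>, z}"
    proof
      fix x assume x: "x \<in> ?ker"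
      then obtain w where w: "w \<in> set H3_words" "x = word_prod C35 ?t w"
        using cover by (auto simp: kernel_def)
      have "foldr J1_perm (mirror w) 61 = 61"
        using x rep_h[OF w(1)] J1_rep_one[of 61] by (simp add: w(2) kernel_def)
      then have "w = [] \<or> w = H3_longest_word" using regular_orbit(2) w(1) by blast
      then show "x \<in> {\<one>\<^bsub>C35\<^esub>, z}" by (auto simp: w(2) z_def)
    qed
  qed (use zc hz in \<open>auto simp: kernel_def\<close>)
  have "central_element C35 = z"
    unfolding central_element_def
  proof (rule the_equality)
    have "z \<otimes>\<^bsub>C35\<^esub> g = g \<otimes>\<^bsub>C35\<^esub> z" if g: "g \<in> carrier C35" for g
    proof -
      have "g \<otimes>\<^bsub>C35\<^esub> z \<otimes>\<^bsub>C35\<^esub> inv\<^bsub>C35\<^esub> g \<in> ?ker" using g zc hz by (simp add: kernel_def)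
      moreover have "g \<otimes>\<^bsub>C35\<^esub> z \<otimes>\<^bsub>C35\<^esub> inv\<^bsub>C35\<^esub> g \<noteq> \<one>\<^bsub>C35\<^esub>"
      proof
        assume "g \<otimes>\<^bsub>C35\<^esub> z \<otimes>\<^bsub>C35\<^esub> inv\<^bsub>C35\<^esub> g = \<one>\<^bsub>C35\<^esub>"
        then have "g \<otimes>\<^bsub>C35\<^esub> z = g" using g zc by (simp add: C.inv_solve_right')
        then show False using z1 g zc by (simp add: C.r_cancel_one)
      qed
      ultimately have "g \<otimes>\<^bsub>C35\<^esub> z \<otimes>\<^bsub>C35\<^esub> inv\<^bsub>C35\<^esub> g = z" using ker by blast
      then show ?thesis using g zc by (simp add: C.inv_solve_right')
    qed
    with zc z1 show "z \<in> carrier C35 \<and> z \<noteq> \<one>\<^bsub>C35\<^esub> \<and> (\<forall>g\<in>carrier C35. z \<otimes>\<^bsub>C35\<^esub> g = g \<otimes>\<^bsub>C35\<^esub> z)"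
      by blast
    fix y assume y: "y \<in> carrier C35 \<and> y \<noteq> \<one>\<^bsub>C35\<^esub> \<and> (\<forall>g\<in>carrier C35. y \<otimes>\<^bsub>C35\<^esub> g = g \<otimes>\<^bsub>C35\<^esub> y)"
    then obtain w where w: "w \<in> set H3_words" "y = word_prod C35 ?t w" using cover by blast
    have hy: "h y = word_prod W_group W_gen (mirror w)" using h_word w by simp
    have lm: "set (mirror w) \<subseteq> {..<4}" using mirror_letters[OF H3_letters[OF w(1)]] by auto
    have "foldr J1_perm (mirror w @ [i]) 61 = foldr J1_perm (i # mirror w) 61" if i: "i \<in> {1,2,3}" for i
    proof -
      have gi: "rank3_gen 3 5 (i - 1) \<in> carrier C35" using rank3_generators(1)[of 3 5] i by auto
      have "i - 1 < 3" "i - 1 + 1 = i" using i by auto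
      then have hi: "h (rank3_gen 3 5 (i - 1)) = W_gen i" using h(2)[of "i - 1"] by (simp only:)
      have "h y \<otimes>\<^bsub>W_group\<^esub> W_gen i = W_gen i \<otimes>\<^bsub>W_group\<^esub> h y"
        using y gi hi h.hom_mult[of y "rank3_gen 3 5 (i - 1)"] h.hom_mult[of "rank3_gen 3 5 (i - 1)" y]
        by auto
      moreover have "W_gen i \<in> carrier W_group" "h y \<in> carrier W_group" "i < 4" using y i W_gen_carrier by auto
      ultimately have "J1_rep (h y) (J1_rep (W_gen i) 61) = J1_rep (W_gen i) (J1_rep (h y) 61)"
        by (metis J1_rep_mult)
      then show ?thesis using lm \<open>i < 4\<close> by (simp add: hy J1_rep_word J1_rep(2))
    qed
    then have "w = [] \<or> w = H3_longest_word" using noncentral w(1) by blast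
    with y w show "y = z" by (auto simp: z_def)
  qed
  with ker show ?thesis by simp
qed

lemma vertex_figure_isomorphic:
  assumes V: "V \<in> proper_faces W_group 4 W_gen 0"
  shows "poset_isomorphic (section_above (polytope W_group 4 W_gen) V) hemi_icosahedron"
proof -
  have f: "(\<lambda>i. W_gen (i + 1)) ` {..<3} \<subseteq> carrier W_group" using W_gen_carrier by auto
  have "word_prod W_group (\<lambda>i. W_gen (i + 1)) u = word_prod W_group (\<lambda>i. W_gen (i + 1)) v"
    if uv: "(u, v) \<in> set (H3_relators [3, 5])" for u v
  proof -
    have "\<forall>(u, v)\<in>set (H3_relators [3, 5]).
        (map (\<lambda>i. i + 1) u, map (\<lambda>i. i + 1) v) \<in> set W_relators"
      unfolding H3_relators_35 W_relators_def by simp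
    with uv have "(map (\<lambda>i. i + 1) u, map (\<lambda>i. i + 1) v) \<in> set W_relators" by blast
    from W_relator[OF this] show ?thesis by (simp only: word_prod_map)
  qed
  from rank3_hom[OF W.group_axioms f this]
  obtain h where h: "h \<in> hom C35 W_group" "\<And>i. i < 3 \<Longrightarrow> h (rank3_gen 3 5 i) = W_gen (i + 1)" by blast
  obtain w where w: "w \<in> carrier W_group" "V = Coset_Face 0 (maximal_parabolic W_group 4 W_gen 0 #>\<^bsub>W_group\<^esub> w)"
    using V by (auto simp: proper_faces_def RCOSETS_def maximal_parabolic_def)
  interpret S: polytope_section W_group C35 W_gen "rank3_gen 3 5" 3 1 0 h w
    by (rule polytope_section.intro) (use W_string_C_group rank3_group rank3_generators h w in simp_all)
  have "S.section = section_above (polytope W_group 4 W_gen) V"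
    unfolding S.section_def w(2) by simp
  with S.section_isomorphic_quotient[OF icosahedral_kernel[OF h]] show ?thesis
    unfolding hemi_icosahedron_def icosahedron_def rank3_group_def[symmetric] rank3_gen_def[symmetric]
    by (simp only:)
qed

theorem mainTheorem1:
  shows "string_C_group W_group 4 W_gen
    \<and> (\<forall>F \<in> proper_faces W_group 4 W_gen 3.
          poset_isomorphic (section_below (polytope W_group 4 W_gen) F) dodecahedron)
    \<and> (\<forall>V \<in> proper_faces W_group 4 W_gen 0.
          poset_isomorphic (section_above (polytope W_group 4 W_gen) V) hemi_icosahedron)"
  using W_string_C_group facet_isomorphic vertex_figure_isomorphic by blast

end
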